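(* Let $n\in\mathbb{N}^*$, $\sigma>0$, and let $(a_n(i))_{1\le i\le n}$ be a nondecreasing sequence of real numbers. Let $B^1,\dots,B^n$ be independent standard real Brownian motions independent of the initial random variables. Then the stochastic differential equation $$dX^{i,n}_t=\sigma\,dB^i_t-a_n\Big(\sum_{j=1}^n1_{\{X^{j,n}_t\le X^{i,n}_t\}}\Big)dt,\qquad X^{i,n}_0=X^i_0,\quad1\le i\le n,\qquad(\mathrm{S})$$ has a unique strong solution. Let $(Y^{1,n}_t,\dots,Y^{n,n}_t)$ denote another solution of (S), starting from $(Y^1_0,\dots,Y^n_0)$ and driven by the same Brownian motion $(B^1,\dots,B^n)$. Then $$\text{a.s., }\forall t\ge0,\qquad\sum_{i=1}^n(X^{i,n}_t-Y^{i,n}_t)^2\le\sum_{i=1}^n(X^i_0-Y^i_0)^2 .$$ In addition, if the initial conditions are such that a.s., for all $i\in\{1,\dots,n\}$, $X^i_0<Y^i_0$ (resp. $X^i_0\le Y^i_0$), then $$\text{a.s., }\forall t\ge0,\ \forall i\in\{1,\dots,n\},\qquad X^{i,n}_t<Y^{i,n}_t\quad(\text{resp. }X^{i,n}_t\le Y^{i,n}_t).$$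
   Context: When two solutions are compared, they are defined on a common probability space and adapted to a common filtration with respect to which $(B^1,\dots,B^n)$ is a Brownian motion, the initial conditions $(X^i_0)_i$ and $(Y^i_0)_i$ being measurable at time $0$ (hence jointly independent of the Brownian motion). *)

theory Defs
  imports "HOL-Probability.Probability"
begin

text \<open>Processes are indexed by real times, of which only \<open>t \<ge> 0\<close> matters.  The \<open>n\<close> particles are
  labelled by a finite type \<open>'n\<close>, so \<open>n = CARD('n) \<ge> 1\<close>.\<close>

definition standard_brownian_motion :: "'w measure \<Rightarrow> (real \<Rightarrow> 'w \<Rightarrow> real) \<Rightarrow> bool" where
  "standard_brownian_motion M W \<longleftrightarrow>
     (\<forall>t\<ge>0. W t \<in> borel_measurable M) \<and>
     (AE \<omega> in M. W 0 \<omega> = 0) \<and>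
     (AE \<omega> in M. continuous_on {0..} (\<lambda>t. W t \<omega>)) \<and>
     (\<forall>s t. 0 \<le> s \<and> s < t \<longrightarrow>
        distributed M lborel (\<lambda>\<omega>. W t \<omega> - W s \<omega>) (normal_density 0 (sqrt (t - s)))) \<and>
     (\<forall>\<tau> :: nat \<Rightarrow> real. 0 \<le> \<tau> 0 \<and> strict_mono \<tau> \<longrightarrow>
        prob_space.indep_vars M (\<lambda>_. borel) (\<lambda>k \<omega>. W (\<tau> (Suc k)) \<omega> - W (\<tau> k) \<omega>) UNIV)"

definition independent_brownian_motions ::
    "'w measure \<Rightarrow> (real \<Rightarrow> 'w \<Rightarrow> real ^ 'n) \<Rightarrow> bool" where
  "independent_brownian_motions M B \<longleftrightarrow>
     (\<forall>i. standard_brownian_motion M (\<lambda>t \<omega>. B t \<omega> $ i)) \<and>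
     prob_space.indep_vars M (\<lambda>_. PiM {0..} (\<lambda>_. borel)) (\<lambda>i \<omega>. \<lambda>t\<in>{0..}. B t \<omega> $ i) UNIV"

text \<open>The library's \<open>indep_var\<close> needs both variables to have the same value type, hence the
  formulation through generated sigma-algebras.\<close>

definition independent_of_process ::
    "'w measure \<Rightarrow> ('w \<Rightarrow> real ^ 'n) \<Rightarrow> (real \<Rightarrow> 'w \<Rightarrow> real ^ 'n) \<Rightarrow> bool" where
  "independent_of_process M X0 B \<longleftrightarrow>
     prob_space.indep_set M
       (sets (vimage_algebra (space M) X0 borel))
       (sets (vimage_algebra (space M) (\<lambda>\<omega>. \<lambda>t\<in>{0..}. B t \<omega>) (PiM {0..} (\<lambda>_. borel))))"

definition brownian_motion_wrt ::
    "'w measure \<Rightarrow> (real \<Rightarrow> 'w measure) \<Rightarrow> (real \<Rightarrow> 'w \<Rightarrow> real ^ 'n) \<Rightarrow> bool" where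
  "brownian_motion_wrt M F B \<longleftrightarrow>
     filtration (space M) F \<and> (\<forall>t. subalgebra M (F t)) \<and>
     independent_brownian_motions M B \<and>
     (\<forall>t\<ge>0. B t \<in> borel_measurable (F t)) \<and>
     (\<forall>s t. 0 \<le> s \<and> s < t \<longrightarrow>
        prob_space.indep_set M (sets (F s))
          (sets (vimage_algebra (space M) (\<lambda>\<omega>. B t \<omega> - B s \<omega>) borel)))"

definition particle_rank :: "real ^ 'n \<Rightarrow> 'n \<Rightarrow> nat" where
  "particle_rank x i = (\<Sum>j\<in>UNIV. of_bool (x $ j \<le> x $ i))"

definition solution ::
    "'w measure \<Rightarrow> (real \<Rightarrow> 'w measure) \<Rightarrow> real \<Rightarrow> (nat \<Rightarrow> real) \<Rightarrow> (real \<Rightarrow> 'w \<Rightarrow> real ^ 'n) \<Rightarrow>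
     ('w \<Rightarrow> real ^ 'n) \<Rightarrow> (real \<Rightarrow> 'w \<Rightarrow> real ^ 'n) \<Rightarrow> bool" where
  "solution M F \<sigma> a B X0 X \<longleftrightarrow>
     X0 \<in> borel_measurable (F 0) \<and>
     (\<forall>t\<ge>0. X t \<in> borel_measurable (F t)) \<and>
     (AE \<omega> in M. X 0 \<omega> = X0 \<omega> \<and> continuous_on {0..} (\<lambda>t. X t \<omega>) \<and>
        (\<forall>t\<ge>0. \<forall>i.
           set_integrable lborel {0..t} (\<lambda>s. a (particle_rank (X s \<omega>) i)) \<and>
           X t \<omega> $ i = X0 \<omega> $ i + \<sigma> * B t \<omega> $ i - (LINT s:{0..t}|lborel. a (particle_rank (X s \<omega>) i))))"

definition augmented_filtration ::
    "'w measure \<Rightarrow> ('w \<Rightarrow> real ^ 'n) \<Rightarrow> (real \<Rightarrow> 'w \<Rightarrow> real ^ 'n) \<Rightarrow> real \<Rightarrow> 'w measure" where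
  "augmented_filtration M X0 B t =
     sigma (space M)
       ({X0 -` A \<inter> space M | A. A \<in> sets borel} \<union>
        {B s -` A \<inter> space M | s A. 0 \<le> s \<and> s \<le> t \<and> A \<in> sets borel} \<union>
        null_sets M)"

definition strong_solution ::
    "'w measure \<Rightarrow> real \<Rightarrow> (nat \<Rightarrow> real) \<Rightarrow> (real \<Rightarrow> 'w \<Rightarrow> real ^ 'n) \<Rightarrow>
     ('w \<Rightarrow> real ^ 'n) \<Rightarrow> (real \<Rightarrow> 'w \<Rightarrow> real ^ 'n) \<Rightarrow> bool" where
  "strong_solution M \<sigma> a B X0 X \<longleftrightarrow> solution M (augmented_filtration M X0 B) \<sigma> a B X0 X"

definition indistinguishable ::
    "'w measure \<Rightarrow> (real \<Rightarrow> 'w \<Rightarrow> 'b) \<Rightarrow> (real \<Rightarrow> 'w \<Rightarrow> 'b) \<Rightarrow> bool" where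
  "indistinguishable M X Y \<longleftrightarrow> (AE \<omega> in M. \<forall>t\<ge>0. X t \<omega> = Y t \<omega>)"

end

theory Submission
  imports Defs
begin

text \<open>Everything is done path by path. For almost every \<open>\<omega>\<close>, the difference of two components of \<open>B\<close>
  coincides with no Lipschitz function on a set of times of positive measure: such a coincidence forces
  \<open>\<bar>B\<^bsub>s+h\<^esub> - B\<^bsub>s\<^esub>\<bar> \<le> L h\<close> for many \<open>s\<close>, whereas this event has probability of order \<open>\<surd>h\<close>. As
  the drift is bounded, a solution therefore has no ties at almost every time. Away from ties, ranks are
  permutations, and a rearrangement inequality makes the drift dissipative both for the Euclidean distance
  and for the squared positive parts of \<open>X - Y\<close>; this gives the contraction and the comparison. For
  existence, ties are broken by a fixed order of the particles; the Euler scheme then converges for every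
  continuous driving path, and its limit solves the equation because it spends no time at ties.\<close>

section \<open>Ranks and the rearrangement inequality\<close>

text \<open>Ties are the obstacle: \<open>particle_rank\<close> gives all tied particles the largest
  of their ranks, and the drift coefficients are then no longer monotone. With two particles,
  \<open>a 1 = 0\<close> and \<open>a 2 = 1\<close>, the configurations x = (0, 0) and y = (1, 2)
  have coefficients (1, 1) and (0, 1); the second minus the first has scalar product -1 with y - x.
  With ties broken, the vector of all \<open>a (tie_rank x i)\<close> is a subgradient of the convex
  function that maps x to the maximum, over all numberings p of the particles, of the sum of
  \<open>a (p i) * x $ i\<close>. The equation is thus a noisy gradient flow, and the rearrangement
  inequality with weights x - y is the monotonicity of the subgradient; it also makes explicit Euler
  steps converge although the drift jumps. The Lipschitz functions to be avoided are drifts of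
  solutions and depend on the path of B. The exceptional null set must therefore be the same for all
  of them, which is why it is defined through the increments of B alone.\<close>

definition tie_rank :: "real ^ 'n \<Rightarrow> 'n \<Rightarrow> nat" where
  "tie_rank x i = card {j. x $ j < x $ i \<or> (x $ j = x $ i \<and> to_nat_on UNIV j \<le> to_nat_on (UNIV :: 'n set) i)}"

lemma tie_rank_mono:
  assumes "tie_rank x i < tie_rank x j"
  shows "x $ i \<le> x $ j"
proof (rule ccontr)
  assume "\<not> ?thesis"
  then have "tie_rank x j \<le> tie_rank x i"
    unfolding tie_rank_def by (intro card_mono) auto
  with assms show False by simp
qed

text \<open>Ordering by position and then by label number is a total order, with
  \<open>to_nat_on UNIV\<close> supplying the numbers. Its initial segments are strictly nested, so
  their sizes differ.\<close>

lemma inj_tie_rank: "inj (tie_rank (x :: real ^ 'n))"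
proof (rule injI, rule ccontr)
  fix i j :: 'n
  define le where "le k l \<longleftrightarrow> x $ k < x $ l \<or> (x $ k = x $ l \<and> to_nat_on UNIV k \<le> to_nat_on (UNIV :: 'n set) l)" for k l
  have less: "card {k. le k p} < card {k. le k q}" if "le p q" "p \<noteq> q" for p q
  proof (rule psubset_card_mono)
    have "to_nat_on UNIV p \<noteq> to_nat_on (UNIV :: 'n set) q"
      using that(2) by (simp add: countable_finite)
    with that(1) have "\<not> le q p" unfolding le_def by auto
    moreover have "le k q" if "le k p" for k
      using that \<open>le p q\<close> unfolding le_def by auto
    moreover have "le q q" unfolding le_def by auto
    ultimately show "{k. le k p} \<subset> {k. le k q}" by blast
  qed auto
  assume "tie_rank x i = tie_rank x j" "i \<noteq> j"
  moreover have "le i j \<or> le j i" unfolding le_def by auto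
  ultimately show False
    using less[of i j] less[of j i] unfolding tie_rank_def le_def by auto
qed

lemma tie_rank_bounds: "tie_rank (x :: real ^ 'n) i \<in> {1..CARD('n)}"
proof -
  have "tie_rank x i > 0"
    unfolding tie_rank_def by (subst card_gt_0_iff) auto
  moreover have "tie_rank x i \<le> CARD('n)"
    unfolding tie_rank_def by (intro card_mono) auto
  ultimately show ?thesis by simp
qed

lemma card_tie_rank_ge:
  assumes "k \<in> {1..CARD('n)}"
  shows "card {i. k \<le> tie_rank (x :: real ^ 'n) i} = CARD('n) + 1 - k"
proof -
  have "range (tie_rank x) = {1..CARD('n)}"
    using tie_rank_bounds[of x]
    by (intro card_subset_eq) (auto simp: card_image[OF inj_tie_rank])
  then have "tie_rank x ` {i. k \<le> tie_rank x i} = {k..CARD('n)}"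
    using assms by (auto simp: image_iff set_eq_iff) (metis assms atLeastAtMost_iff le_trans)+
  then have "card {i. k \<le> tie_rank x i} = card {k..CARD('n)}"
    by (metis card_image inj_on_subset inj_tie_rank subset_UNIV)
  then show ?thesis by simp
qed

lemma particle_rank_eq_card: "particle_rank x i = card {j. x $ j \<le> x $ i}"
  unfolding particle_rank_def by (simp add: Collect_conv_if sum.If_cases of_bool_def)

lemma particle_rank_bounds: "particle_rank (x :: real ^ 'n) i \<in> {1..CARD('n)}"
proof -
  have "particle_rank x i > 0"
    unfolding particle_rank_eq_card by (subst card_gt_0_iff) auto
  moreover have "particle_rank x i \<le> CARD('n)"
    unfolding particle_rank_eq_card by (intro card_mono) auto
  ultimately show ?thesis by simp
qed

text \<open>This links the equation, stated with \<open>particle_rank\<close>, to the rearrangement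
  inequality, which holds for \<open>tie_rank\<close>.\<close>

lemma tie_rank_eq_particle_rank:
  assumes "inj (($) x)"
  shows "tie_rank x i = particle_rank x i"
  unfolding tie_rank_def particle_rank_eq_card
  by (rule arg_cong[where f = card]) (use assms in \<open>auto simp: inj_eq le_less\<close>)

text \<open>The differences \<open>B - A\<close> and \<open>A - B\<close> have the same size, and
  any bijection between them may be used, because the last assumption compares every pair.\<close>

lemma sum_le_sum_card_eq:
  fixes g :: "'a \<Rightarrow> real"
  assumes "finite A" "finite B" "card A = card B"
    and "\<And>i j. i \<in> B - A \<Longrightarrow> j \<in> A - B \<Longrightarrow> g i \<le> g j"
  shows "sum g B \<le> sum g A"
proof -
  have "card (B - A) = card (A - B)"
    using assms(1-3) card_Diff_subset_Int[of A B] card_Diff_subset_Int[of B A]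
    by (simp add: Int_commute)
  then obtain f where f: "bij_betw f (B - A) (A - B)"
    using assms(1,2) by (meson bij_betw_iff_card finite_Diff)
  have "sum g (B - A) \<le> sum (\<lambda>i. g (f i)) (B - A)"
    using f by (intro sum_mono assms(4)) (auto simp: bij_betw_def)
  also have "\<dots> = sum g (A - B)"
    by (rule sum.reindex_bij_betw[OF f])
  finally show ?thesis
    using sum.Int_Diff[OF assms(1), of g B] sum.Int_Diff[OF assms(2), of g A]
    by (simp add: Int_commute)
qed

text \<open>Abel summation in \<open>a\<close> reduces the inequality to the sets of particles of rank at least \<open>k\<close>, which
  have the same cardinality for both configurations.\<close>

lemma sum_weighted_rank_mono:
  fixes x y :: "real ^ 'n" and g :: "'n \<Rightarrow> real"
  assumes a: "mono_on {1..CARD('n)} a"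
    and g: "\<And>i j. x $ i \<le> x $ j \<Longrightarrow> y $ j \<le> y $ i \<Longrightarrow> g i \<le> g j"
  shows "(\<Sum>i\<in>UNIV. g i * a (tie_rank y i)) \<le> (\<Sum>i\<in>UNIV. g i * a (tie_rank x i))"
proof -
  let ?n = "CARD('n)"
  \<comment> \<open>The sum starts at 2 because \<open>a\<close> is monotone only from index 1 on:
    \<open>a 1 - a 0\<close> could be negative.\<close>
  have abel: "a m = a 1 + (\<Sum>k\<in>{2..?n}. (a k - a (k - 1)) * of_bool (k \<le> m))" if "m \<in> {1..?n}" for m
  proof -
    have "(\<Sum>k\<in>{2..?n}. (a k - a (k - 1)) * of_bool (k \<le> m)) = (\<Sum>k\<in>{2..m}. a k - a (k - 1))"
      using that by (intro sum.mono_neutral_cong_right) auto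
    also have "\<dots> = a m - a 1"
      using that sum_telescope''[of 1 m a] by (simp add: numeral_2_eq_2 atLeastSucAtMost_greaterThanAtMost)
    finally show ?thesis by simp
  qed
  have eq: "(\<Sum>i\<in>UNIV. g i * a (tie_rank z i)) =
      (\<Sum>i\<in>UNIV. g i * a 1) + (\<Sum>k\<in>{2..?n}. (a k - a (k - 1)) * sum g {i. k \<le> tie_rank z i})"
    for z :: "real ^ 'n"
  proof -
    have ge: "(\<Sum>i\<in>UNIV. g i * of_bool (k \<le> tie_rank z i)) = sum g {i. k \<le> tie_rank z i}" for k
      by (intro sum.mono_neutral_cong_right) auto
    have "(\<Sum>i\<in>UNIV. g i * a (tie_rank z i)) =
        (\<Sum>i\<in>UNIV. g i * a 1 + (\<Sum>k\<in>{2..?n}. (a k - a (k - 1)) * (g i * of_bool (k \<le> tie_rank z i))))"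
      by (subst abel[OF tie_rank_bounds]) (simp only: distrib_left sum_distrib_left mult.left_commute)
    also have "\<dots> = (\<Sum>i\<in>UNIV. g i * a 1) +
        (\<Sum>k\<in>{2..?n}. (a k - a (k - 1)) * (\<Sum>i\<in>UNIV. g i * of_bool (k \<le> tie_rank z i)))"
      unfolding sum.distrib by (subst sum.swap) (simp only: sum_distrib_left)
    finally show ?thesis
      unfolding ge .
  qed
  show ?thesis
    unfolding eq
  proof (intro add_left_mono sum_mono mult_left_mono sum_le_sum_card_eq)
    fix k assume k: "k \<in> {2..?n}"
    show "card {i. k \<le> tie_rank x i} = card {i. k \<le> tie_rank y i}"
      using k by (simp add: card_tie_rank_ge)
    show "0 \<le> a k - a (k - 1)"
      using k by (simp, intro monotone_onD[OF a]) auto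
    fix i j assume "i \<in> {i. k \<le> tie_rank y i} - {i. k \<le> tie_rank x i}"
      and "j \<in> {i. k \<le> tie_rank x i} - {i. k \<le> tie_rank y i}"
    \<comment> \<open>The level \<open>k\<close> separates i and j in opposite ways for x and y, so
      \<open>x $ i \<le> x $ j\<close> and \<open>y $ j \<le> y $ i\<close>: exactly the
      disagreement for which \<open>g\<close> is assumed monotone.\<close>
    then show "g i \<le> g j"
      by (intro g tie_rank_mono) auto
  qed auto
qed

text \<open>Without ties, the ranks are determined by finitely many strict inequalities, and these
  survive small perturbations. This is how the ranks of the Euler scheme converge.\<close>

lemma tie_rank_eqI:
  assumes "inj (($) x)" "\<And>j k. x $ j < x $ k \<Longrightarrow> y $ j < y $ k"
  shows "tie_rank y i = tie_rank x i"
proof -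
  have "y $ j < y $ k \<longleftrightarrow> x $ j < x $ k" for j k
    using assms by (metis injD less_asym linorder_neqE_linordered_idom less_irrefl)
  moreover have "y $ j = y $ k \<longleftrightarrow> x $ j = x $ k" for j k
    using assms by (metis injD less_irrefl linorder_neqE_linordered_idom)
  ultimately show ?thesis
    unfolding tie_rank_def by simp
qed

section \<open>Measurability of the ranks\<close>

lemma measurable_card_Collect:
  assumes "\<And>j :: 'n :: finite. Measurable.pred N (P j)"
  shows "(\<lambda>z. card {j. P j z}) \<in> measurable N (count_space UNIV)"
proof -
  have "(\<lambda>z. {j. P j z}) \<in> measurable N (count_space UNIV)"
  proof (subst measurable_count_space_eq2, simp, intro conjI ballI)
    fix S :: "'n set"
    have "(\<lambda>z. {j. P j z}) -` {S} \<inter> space N = {z \<in> space N. \<forall>j. P j z = (j \<in> S)}"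
      by auto
    also have "\<dots> \<in> sets N" using assms by measurable
    finally show "(\<lambda>z. {j. P j z}) -` {S} \<inter> space N \<in> sets N" .
  qed auto
  then show ?thesis
    by (rule measurable_compose) simp
qed

lemma borel_measurable_vec_nth_compose [measurable (raw)]:
  "f \<in> borel_measurable N \<Longrightarrow> (\<lambda>z. f z $ i :: real) \<in> borel_measurable N"
  by (rule borel_measurable_continuous_on[where f = "\<lambda>v. v $ i"]) (auto intro: continuous_intros)

lemma measurable_tie_rank [measurable (raw)]:
  assumes [measurable]: "f \<in> borel_measurable N"
  shows "(\<lambda>z. tie_rank (f z) i) \<in> measurable N (count_space UNIV)"
  unfolding tie_rank_def by (intro measurable_card_Collect) measurable

lemma measurable_particle_rank [measurable (raw)]:
  assumes [measurable]: "f \<in> borel_measurable N"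
  shows "(\<lambda>z. particle_rank (f z) i) \<in> measurable N (count_space UNIV)"
  unfolding particle_rank_eq_card by (intro measurable_card_Collect) measurable

section \<open>An energy inequality without differentiation\<close>

lemma set_integral_Icc_combine:
  fixes f :: "real \<Rightarrow> real"
  assumes "a \<le> b" "b \<le> c" "set_integrable lborel {a..c} f"
  shows "(LINT x:{a..c}|lborel. f x) = (LINT x:{a..b}|lborel. f x) + (LINT x:{b..c}|lborel. f x)"
proof -
  have "set_integrable lborel {a..b} f" "set_integrable lborel {b..c} f"
    using assms by (auto intro!: set_integrable_subset[OF assms(3)])
  then show ?thesis
    using assms by (simp add: set_borel_integral_eq_integral Henstock_Kurzweil_Integration.integral_combine)
qed

lemma set_integral_Icc_same: "(LINT x:{a..a::real}|lborel. f x :: real) = 0"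
  unfolding set_lebesgue_integral_def
proof (rule integral_eq_zero_AE)
  show "AE x in lborel. indicator {a..a} x *\<^sub>R f x = 0"
    using AE_lborel_singleton[of a] by eventually_elim auto
qed

lemma abs_set_integral_Icc_le:
  fixes f :: "real \<Rightarrow> real"
  assumes "a \<le> b" "set_integrable lborel {a..b} f" "\<And>x. x \<in> {a..b} \<Longrightarrow> \<bar>f x\<bar> \<le> K"
  shows "\<bar>LINT x:{a..b}|lborel. f x\<bar> \<le> K * (b - a)"
proof -
  have const: "set_integrable lborel {a..b} (\<lambda>x. c)" "(LINT x:{a..b}|lborel. c) = c * (b - a)" for c :: real
    using assms(1) by (simp_all add: set_integrable_def set_lebesgue_integral_def)
  have "(LINT x:{a..b}|lborel. f x) \<le> (LINT x:{a..b}|lborel. K)"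
    using assms(3) by (intro set_integral_mono assms(2) const) (auto simp: abs_le_iff)
  moreover have "(LINT x:{a..b}|lborel. - K) \<le> (LINT x:{a..b}|lborel. f x)"
    using assms(3) by (intro set_integral_mono assms(2) const) (fastforce simp: abs_le_iff)
  ultimately show ?thesis
    unfolding const by (simp add: abs_le_iff)
qed

text \<open>Summed over \<open>Suc N\<close> equal steps of the interval from 0 to T, the quadratic
  terms contribute \<open>C * T\<^sup>2 / Suc N\<close>, which tends to 0.\<close>

lemma le_of_quadratic_increments:
  fixes G :: "real \<Rightarrow> real"
  assumes "0 \<le> T"
    and G: "\<And>s t. 0 \<le> s \<Longrightarrow> s \<le> t \<Longrightarrow> t \<le> T \<Longrightarrow> G t \<le> G s + \<delta> * (t - s) + C * (t - s)\<^sup>2"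
  shows "G T \<le> G 0 + \<delta> * T"
proof -
  have "G T \<le> G 0 + \<delta> * T + C * T\<^sup>2 / real (Suc N)" for N
  proof -
    define h where "h = T / real (Suc N)"
    have h: "0 \<le> h" "real (Suc N) * h = T"
      using \<open>0 \<le> T\<close> by (simp_all add: h_def)
    have "G (real k * h) \<le> G 0 + real k * (\<delta> * h + C * h\<^sup>2)" if "k \<le> Suc N" for k
      using that
    proof (induction k)
      case (Suc k)
      have "real (Suc k) * h \<le> real (Suc N) * h"
        using Suc.prems h by (intro mult_right_mono) auto
      then have "G (real (Suc k) * h) \<le> G (real k * h) + \<delta> * h + C * h\<^sup>2"
        using G[of "real k * h" "real (Suc k) * h"] h by (simp add: algebra_simps)
      with Suc show ?case by (simp add: algebra_simps)
    qed simp
    from this[of "Suc N"] have "G T \<le> G 0 + (\<delta> * (real (Suc N) * h) + C * h * (real (Suc N) * h))"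
      unfolding h(2) by (simp add: h(2)[symmetric] algebra_simps power2_eq_square)
    then show ?thesis
      unfolding h(2) by (simp add: h_def power2_eq_square)
  qed
  moreover have "(\<lambda>N. G 0 + \<delta> * T + C * T\<^sup>2 / real (Suc N)) \<longlonglongrightarrow> G 0 + \<delta> * T + 0"
    by (intro tendsto_intros LIMSEQ_Suc[OF lim_const_over_n])
  ultimately show ?thesis
    by (intro LIMSEQ_le_const[where X = "\<lambda>N. G 0 + \<delta> * T + C * T\<^sup>2 / real (Suc N)"]) auto
qed

text \<open>A differential inequality \<open>(\<Sum>\<^sub>i \<psi> (D\<^sub>i))' \<le> \<delta>\<close> in integrated form, with \<open>\<eta> = \<psi>'\<close>; the quadratic
  remainder vanishes along subdivisions, so no differentiation theorem is needed.\<close>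

lemma energy_le:
  fixes D \<gamma> :: "real \<Rightarrow> 'i :: finite \<Rightarrow> real"
  assumes "0 \<le> T"
    and D: "\<And>t i. 0 \<le> t \<Longrightarrow> t \<le> T \<Longrightarrow> D t i = D 0 i + (LINT s:{0..t}|lborel. \<gamma> s i)"
    and int: "\<And>i. set_integrable lborel {0..T} (\<lambda>s. \<gamma> s i)"
    and bound: "\<And>s i. s \<in> {0..T} \<Longrightarrow> \<bar>\<gamma> s i\<bar> \<le> K"
    and diss: "AE s in lborel. s \<in> {0..T} \<longrightarrow> (\<Sum>i\<in>UNIV. \<eta> (D s i) * \<gamma> s i) \<le> \<delta>"
    and \<psi>: "\<And>x y. \<psi> y \<le> \<psi> x + \<eta> x * (y - x) + (y - x)\<^sup>2"
    and \<eta>: "\<And>x y. \<bar>\<eta> x - \<eta> y\<bar> \<le> 2 * \<bar>x - y\<bar>"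
  shows "(\<Sum>i\<in>UNIV. \<psi> (D T i)) \<le> (\<Sum>i\<in>UNIV. \<psi> (D 0 i)) + \<delta> * T"
\<comment> \<open>In \<open>C\<close>, one multiple of \<open>CARD('i) * K\<^sup>2\<close> bounds
  the remainders of \<open>\<psi>\<close>; two more come from replacing
  \<open>\<eta> (D s i)\<close> by \<open>\<eta> (D u i)\<close> under the integral, as \<eta> is
  2-Lipschitz.\<close>
proof (rule le_of_quadratic_increments[where G = "\<lambda>t. \<Sum>i\<in>UNIV. \<psi> (D t i)" and C = "3 * real CARD('i) * K\<^sup>2", OF \<open>0 \<le> T\<close>])
  fix s t assume st: "0 \<le> s" "s \<le> t" "t \<le> T"
  let ?n = "real CARD('i)"
  have "0 \<le> K"
    using bound[of 0] \<open>0 \<le> T\<close> by (meson abs_ge_zero atLeastAtMost_iff order_refl order_trans)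
  have incr: "D v i - D u i = (LINT r:{u..v}|lborel. \<gamma> r i)" if "0 \<le> u" "u \<le> v" "v \<le> T" for u v i
    using that D[of u i] D[of v i]
      set_integral_Icc_combine[of 0 u v "\<lambda>r. \<gamma> r i"] set_integrable_subset[OF int, of "{0..v}" i]
    by auto
  have ints: "set_integrable lborel {u..v} (\<lambda>r. \<gamma> r i)" if "0 \<le> u" "v \<le> T" for u v i
    using that by (intro set_integrable_subset[OF int]) auto
  have lip: "\<bar>D v i - D u i\<bar> \<le> K * (t - s)" if "s \<le> u" "u \<le> v" "v \<le> t" for u v i
  proof -
    have "\<bar>D v i - D u i\<bar> \<le> K * (v - u)"
      using that st by (subst incr) (auto intro!: abs_set_integral_Icc_le ints bound)
    also have "\<dots> \<le> K * (t - s)"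
      using that \<open>0 \<le> K\<close> by (intro mult_left_mono) auto
    finally show ?thesis .
  qed
  have "(\<Sum>i\<in>UNIV. \<psi> (D t i)) \<le> (\<Sum>i\<in>UNIV. \<psi> (D s i) + \<eta> (D s i) * (D t i - D s i) + (K * (t - s))\<^sup>2)"
  proof (rule sum_mono)
    fix i
    have "(D t i - D s i)\<^sup>2 \<le> (K * (t - s))\<^sup>2"
      using lip[of s t i] st \<open>0 \<le> K\<close> by (subst abs_le_square_iff[symmetric]) (auto simp: abs_mult)
    then show "\<psi> (D t i) \<le> \<psi> (D s i) + \<eta> (D s i) * (D t i - D s i) + (K * (t - s))\<^sup>2"
      using \<psi>[of "D t i" "D s i"] by linarith
  qed
  also have "\<dots> = (\<Sum>i\<in>UNIV. \<psi> (D s i)) + (\<Sum>i\<in>UNIV. \<eta> (D s i) * (D t i - D s i)) + ?n * (K * (t - s))\<^sup>2"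
    by (simp add: sum.distrib)
  also have "(\<Sum>i\<in>UNIV. \<eta> (D s i) * (D t i - D s i)) =
      (LINT u:{s..t}|lborel. (\<Sum>i\<in>UNIV. \<eta> (D s i) * \<gamma> u i))"
    using st ints[of s t]
    by (simp add: incr set_lebesgue_integral_def set_integrable_def sum_distrib_left
        Bochner_Integration.integral_sum mult.left_commute[of "indicator _ _"])
  also have "\<dots> \<le> (LINT u:{s..t}|lborel. \<delta> + ?n * (2 * (K * (t - s)) * K))"
  proof (rule set_integral_mono_AE)
    show "set_integrable lborel {s..t} (\<lambda>u. \<Sum>i\<in>UNIV. \<eta> (D s i) * \<gamma> u i)"
      using st ints[of s t] unfolding set_integrable_def
      by (simp add: sum_distrib_left mult.left_commute[of "indicator _ _"])
    show "set_integrable lborel {s..t} (\<lambda>u. \<delta> + ?n * (2 * (K * (t - s)) * K))"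
      using st by (simp add: set_integrable_def)
    show "AE u \<in> {s..t} in lborel. (\<Sum>i\<in>UNIV. \<eta> (D s i) * \<gamma> u i) \<le> \<delta> + ?n * (2 * (K * (t - s)) * K)"
      using diss
    proof eventually_elim
      case (elim u)
      show ?case
      proof
        assume u: "u \<in> {s..t}"
        have "(\<Sum>i\<in>UNIV. \<eta> (D s i) * \<gamma> u i) \<le> (\<Sum>i\<in>UNIV. \<eta> (D u i) * \<gamma> u i + 2 * (K * (t - s)) * K)"
        proof (rule sum_mono)
          fix i
          have "\<bar>\<eta> (D s i) - \<eta> (D u i)\<bar> \<le> 2 * (K * (t - s))"
            using \<eta>[of "D s i" "D u i"] lip[of s u i] u by (auto simp: abs_minus_commute)
          then have "\<bar>(\<eta> (D s i) - \<eta> (D u i)) * \<gamma> u i\<bar> \<le> 2 * (K * (t - s)) * K"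
            unfolding abs_mult using bound[of u i] u st by (intro mult_mono) auto
          then show "\<eta> (D s i) * \<gamma> u i \<le> \<eta> (D u i) * \<gamma> u i + 2 * (K * (t - s)) * K"
            by (simp add: algebra_simps)
        qed
        also have "\<dots> \<le> \<delta> + ?n * (2 * (K * (t - s)) * K)"
          using elim u st by (simp add: sum.distrib)
        finally show "(\<Sum>i\<in>UNIV. \<eta> (D s i) * \<gamma> u i) \<le> \<delta> + ?n * (2 * (K * (t - s)) * K)" .
      qed
    qed
  qed
  also have "\<dots> = (t - s) * (\<delta> + ?n * (2 * (K * (t - s)) * K))"
    using st by (simp add: set_lebesgue_integral_def)
  finally show "(\<Sum>i\<in>UNIV. \<psi> (D t i)) \<le> (\<Sum>i\<in>UNIV. \<psi> (D s i)) + \<delta> * (t - s) + 3 * ?n * K\<^sup>2 * (t - s)\<^sup>2"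
    by (simp add: algebra_simps power2_eq_square)
qed

section \<open>Stability and comparison along a path\<close>

lemma set_integrable_Icc_bounded:
  fixes f :: "real \<Rightarrow> real"
  assumes "set_borel_measurable lborel {a..b} f" "\<And>x. x \<in> {a..b} \<Longrightarrow> \<bar>f x\<bar> \<le> K"
  shows "set_integrable lborel {a..b} f"
proof (rule set_integrable_bound)
  show "set_integrable lborel {a..b} (\<lambda>_. K)"
    by (cases "a \<le> b") (simp_all add: set_integrable_def)
qed (use assms in \<open>auto intro!: AE_I2 order_trans[OF _ abs_ge_self]\<close>)

text \<open>The equation along one sample path, with the initial position absorbed into
  \<open>w\<close>, that is \<open>w t = X0 + \<sigma> B t\<close>. At t = 0 it reads
  \<open>X 0 = w 0\<close>, so no separate initial condition appears, and two solutions with the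
  same noise have driving paths that differ by a constant.\<close>

definition rank_path :: "(nat \<Rightarrow> real) \<Rightarrow> (real \<Rightarrow> real ^ 'n) \<Rightarrow> (real \<Rightarrow> real ^ 'n) \<Rightarrow> bool" where
  "rank_path a w X \<longleftrightarrow>
     (\<forall>t\<ge>0. \<forall>i. set_integrable lborel {0..t} (\<lambda>s. a (particle_rank (X s) i)) \<and>
        X t $ i = w t $ i - (LINT s:{0..t}|lborel. a (particle_rank (X s) i)))"

text \<open>Almost every \<open>\<sigma>B\<close> has this property, which forces the ties of \<open>w\<close> minus any Lipschitz drift to
  occupy a null set of times.\<close>

definition lipschitz_avoiding :: "(real \<Rightarrow> real ^ 'n) \<Rightarrow> bool" where
  "lipschitz_avoiding w \<longleftrightarrow>
     (\<forall>i j L f. i \<noteq> j \<longrightarrow> L-lipschitz_on {0..} f \<longrightarrow> (AE s in lborel. 0 \<le> s \<longrightarrow> w s $ i - w s $ j \<noteq> f s))"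

lemma rank_bound: "\<exists>K\<ge>0. \<forall>k\<in>{1..CARD('n::finite)}. \<bar>a k :: real\<bar> \<le> K"
proof -
  let ?K = "Max ((\<lambda>k. \<bar>a k\<bar>) ` {1..CARD('n)})"
  have *: "\<bar>a k\<bar> \<le> ?K" if "k \<in> {1..CARD('n)}" for k
    using that by (intro Max_ge) auto
  moreover have "0 \<le> ?K"
    by (rule order_trans[OF abs_ge_zero *[of 1]]) simp
  ultimately show ?thesis by blast
qed

text \<open>A tie of i and j is a coincidence of \<open>w s $ i - w s $ j\<close> with the
  difference of two accumulated drifts, which is \<open>K + K\<close>-Lipschitz. Since only the
  Lipschitz bound on \<open>w - X\<close> enters, the lemma also applies to the limit of the Euler
  scheme before that limit is known to solve the equation.\<close>

lemma AE_no_ties: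
  fixes w X :: "real \<Rightarrow> real ^ 'n"
  assumes w: "lipschitz_avoiding w"
    and V: "\<And>i. K-lipschitz_on {0..} (\<lambda>t. w t $ i - X t $ i)"
  shows "AE s in lborel. 0 \<le> s \<longrightarrow> inj (($) (X s))"
proof -
  have "AE s in lborel. i \<noteq> j \<longrightarrow> 0 \<le> s \<longrightarrow> X s $ i \<noteq> X s $ j" for i j
  proof (cases "i = j")
    case False
    have "(K + K)-lipschitz_on {0..} (\<lambda>t. (w t $ i - X t $ i) - (w t $ j - X t $ j))"
      by (intro lipschitz_on_diff V)
    with w False have "AE s in lborel. 0 \<le> s \<longrightarrow>
        w s $ i - w s $ j \<noteq> (w s $ i - X s $ i) - (w s $ j - X s $ j)"
      unfolding lipschitz_avoiding_def by blast
    then show ?thesis by eventually_elim auto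
  qed simp
  then have "AE s in lborel. \<forall>i j. i \<noteq> j \<longrightarrow> 0 \<le> s \<longrightarrow> X s $ i \<noteq> X s $ j"
    by (intro eventually_all_finite)
  then show ?thesis
    by eventually_elim (auto simp: inj_def)
qed

lemma set_integral_lipschitz_on:
  fixes f :: "real \<Rightarrow> real"
  assumes "\<And>t. 0 \<le> t \<Longrightarrow> set_integrable lborel {0..t} f" "\<And>s. 0 \<le> s \<Longrightarrow> \<bar>f s\<bar> \<le> K" "0 \<le> K"
  shows "K-lipschitz_on {0..} (\<lambda>t. LINT s:{0..t}|lborel. f s)"
proof (rule lipschitz_onI)
  have *: "\<bar>(LINT s:{0..v}|lborel. f s) - (LINT s:{0..u}|lborel. f s)\<bar> \<le> K * (v - u)"
    if "0 \<le> u" "u \<le> v" for u v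
    using that assms set_integral_Icc_combine[of 0 u v f] set_integrable_subset[OF assms(1), of v "{u..v}"]
      abs_set_integral_Icc_le[of u v f K]
    by auto
  fix x y :: real assume "x \<in> {0..}" "y \<in> {0..}"
  then show "dist (LINT s:{0..x}|lborel. f s) (LINT s:{0..y}|lborel. f s) \<le> K * dist x y"
    using *[of x y] *[of y x] by (cases "x \<le> y") (auto simp: dist_real_def abs_minus_commute)
qed fact

lemma rank_path_no_ties:
  fixes w X :: "real \<Rightarrow> real ^ 'n"
  assumes "lipschitz_avoiding w" and X: "rank_path a w X"
  shows "AE s in lborel. 0 \<le> s \<longrightarrow> inj (($) (X s))"
proof -
  obtain K where K: "0 \<le> K" "\<And>k. k \<in> {1..CARD('n)} \<Longrightarrow> \<bar>a k\<bar> \<le> K"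
    using rank_bound[where 'n = 'n and a = a] by blast
  show ?thesis
  proof (rule AE_no_ties[OF assms(1)])
    fix i
    have "K-lipschitz_on {0..} (\<lambda>t. LINT s:{0..t}|lborel. a (particle_rank (X s) i))"
      using X K(1) K(2)[OF particle_rank_bounds]
      by (intro set_integral_lipschitz_on) (auto simp: rank_path_def)
    then show "K-lipschitz_on {0..} (\<lambda>t. w t $ i - X t $ i)"
      by (rule lipschitz_on_transform) (use X in \<open>simp add: rank_path_def\<close>)
  qed
qed

text \<open>The noise cancels in \<open>X - Y\<close> because \<open>w - v\<close> is constant in
  time, so what remains is an integral of rank differences. If X_i \<le> X_j and Y_j \<le> Y_i, then
  X_i - Y_i \<le> X_j - Y_j; hence for increasing \<eta> the weights
  \<open>\<eta> (X s $ i - Y s $ i)\<close> are admissible in the rearrangement inequality.\<close>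

lemma rank_path_energy_le:
  fixes w v X Y :: "real \<Rightarrow> real ^ 'n"
  assumes a: "mono_on {1..CARD('n)} a"
    and w: "lipschitz_avoiding w" "lipschitz_avoiding v" "\<And>t. 0 \<le> t \<Longrightarrow> w t - v t = w 0 - v 0"
    and X: "rank_path a w X" and Y: "rank_path a v Y"
    and \<psi>: "\<And>x y. \<psi> y \<le> \<psi> x + \<eta> x * (y - x) + (y - x)\<^sup>2"
    and \<eta>: "\<And>x y. \<bar>\<eta> x - \<eta> y\<bar> \<le> 2 * \<bar>x - y\<bar>" "mono \<eta>"
    and "0 \<le> t"
  shows "(\<Sum>i\<in>UNIV. \<psi> (X t $ i - Y t $ i)) \<le> (\<Sum>i\<in>UNIV. \<psi> (X 0 $ i - Y 0 $ i))"
proof -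
  obtain K where K: "0 \<le> K" "\<And>k. k \<in> {1..CARD('n)} \<Longrightarrow> \<bar>a k\<bar> \<le> K"
    using rank_bound[where 'n = 'n and a = a] by blast
  let ?\<gamma> = "\<lambda>s i. a (particle_rank (Y s) i) - a (particle_rank (X s) i)"
  have "(\<Sum>i\<in>UNIV. \<psi> (X t $ i - Y t $ i)) \<le> (\<Sum>i\<in>UNIV. \<psi> (X 0 $ i - Y 0 $ i)) + 0 * t"
  proof (rule energy_le[where D = "\<lambda>t i. X t $ i - Y t $ i" and \<gamma> = ?\<gamma> and K = "K + K" and \<eta> = \<eta>, OF \<open>0 \<le> t\<close>])
    fix s :: real and i assume "0 \<le> s"
    have "w s $ i - v s $ i = w 0 $ i - v 0 $ i"
      using w(3)[OF \<open>0 \<le> s\<close>] by (metis vector_minus_component)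
    moreover have "X 0 $ i = w 0 $ i" "Y 0 $ i = v 0 $ i"
      using X Y by (auto simp: rank_path_def set_integral_Icc_same[of 0, simplified])
    ultimately show "X s $ i - Y s $ i = X 0 $ i - Y 0 $ i + (LINT s:{0..s}|lborel. ?\<gamma> s i)"
      using X Y \<open>0 \<le> s\<close> by (simp add: rank_path_def)
  next
    show "set_integrable lborel {0..t} (\<lambda>s. ?\<gamma> s i)" for i
      using X Y \<open>0 \<le> t\<close> by (auto simp: rank_path_def)
    show "\<bar>?\<gamma> s i\<bar> \<le> K + K" for s i
      using K(2)[OF particle_rank_bounds] by (intro order_trans[OF abs_triangle_ineq4] add_mono)
    show "AE s in lborel. s \<in> {0..t} \<longrightarrow> (\<Sum>i\<in>UNIV. \<eta> (X s $ i - Y s $ i) * ?\<gamma> s i) \<le> 0"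
      using rank_path_no_ties[OF w(1) X] rank_path_no_ties[OF w(2) Y]
    proof eventually_elim
      case (elim s)
      show ?case
      proof
        assume "s \<in> {0..t}"
        with elim have "(\<Sum>i\<in>UNIV. \<eta> (X s $ i - Y s $ i) * ?\<gamma> s i) =
            (\<Sum>i\<in>UNIV. \<eta> (X s $ i - Y s $ i) * a (tie_rank (Y s) i)) -
            (\<Sum>i\<in>UNIV. \<eta> (X s $ i - Y s $ i) * a (tie_rank (X s) i))"
          by (simp add: tie_rank_eq_particle_rank right_diff_distrib sum_subtractf)
        also have "\<dots> \<le> 0"
          using sum_weighted_rank_mono[OF a, of "X s" "Y s" "\<lambda>i. \<eta> (X s $ i - Y s $ i)"]
            monoD[OF \<eta>(2)] by fastforce
        finally show "(\<Sum>i\<in>UNIV. \<eta> (X s $ i - Y s $ i) * ?\<gamma> s i) \<le> 0" .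
      qed
    qed
  qed fact+
  then show ?thesis by simp
qed

lemma rank_path_contraction:
  fixes w v X Y :: "real \<Rightarrow> real ^ 'n"
  assumes "mono_on {1..CARD('n)} a"
    and "lipschitz_avoiding w" "lipschitz_avoiding v" "\<And>t. 0 \<le> t \<Longrightarrow> w t - v t = w 0 - v 0"
    and "rank_path a w X" "rank_path a v Y" "0 \<le> t"
  shows "(\<Sum>i\<in>UNIV. (X t $ i - Y t $ i)\<^sup>2) \<le> (\<Sum>i\<in>UNIV. (X 0 $ i - Y 0 $ i)\<^sup>2)"
  by (rule rank_path_energy_le[where \<psi> = "\<lambda>x. x\<^sup>2" and \<eta> = "\<lambda>x. 2 * x", OF assms(1-6) _ _ _ assms(7)])
    (auto simp: power2_eq_square algebra_simps mono_def abs_if)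

lemma rank_path_le:
  fixes w v X Y :: "real \<Rightarrow> real ^ 'n"
  assumes "mono_on {1..CARD('n)} a"
    and "lipschitz_avoiding w" "lipschitz_avoiding v" "\<And>t. 0 \<le> t \<Longrightarrow> w t - v t = w 0 - v 0"
    and "rank_path a w X" "rank_path a v Y" "0 \<le> t"
    and le: "\<And>i. X 0 $ i \<le> Y 0 $ i"
  shows "X t $ i \<le> Y t $ i"
proof -
  have "(\<Sum>i\<in>UNIV. (max 0 (X t $ i - Y t $ i))\<^sup>2) \<le> (\<Sum>i\<in>UNIV. (max 0 (X 0 $ i - Y 0 $ i))\<^sup>2)"
  proof (rule rank_path_energy_le[where \<psi> = "\<lambda>x. (max 0 x)\<^sup>2" and \<eta> = "\<lambda>x. 2 * max 0 x", OF assms(1-6) _ _ _ assms(7)])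
    fix x y :: real
    \<comment> \<open>For x \<ge> 0 the right-hand side of the goal is exactly
      \<open>y\<^sup>2\<close>. For x \<le> 0 it is \<open>(y - x)\<^sup>2\<close>, and y - x \<ge>
      y.\<close>
    have "(max 0 y)\<^sup>2 \<le> y\<^sup>2"
      by (simp add: max_def)
    moreover have "x * y \<le> 0" if "x \<ge> 0" "y \<le> 0"
      using that by (simp add: mult_nonneg_nonpos)
    moreover have "(max 0 y)\<^sup>2 \<le> (y - x)\<^sup>2" if "x \<le> 0"
      using that by (subst abs_le_square_iff[symmetric]) auto
    ultimately show "(max 0 y)\<^sup>2 \<le> (max 0 x)\<^sup>2 + 2 * max 0 x * (y - x) + (y - x)\<^sup>2"
      by (cases "x \<le> 0") (auto simp: max_def power2_eq_square algebra_simps)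
  qed (auto simp: mono_def max_def abs_if)
  also have "\<dots> = 0"
    using le by (intro sum.neutral) (auto simp: max_absorb1)
  finally have "(\<Sum>i\<in>UNIV. (max 0 (X t $ i - Y t $ i))\<^sup>2) = 0"
    by (intro antisym sum_nonneg) auto
  then have "(max 0 (X t $ i - Y t $ i))\<^sup>2 = 0"
    by (subst (asm) sum_nonneg_eq_0_iff) auto
  then show ?thesis by (simp add: max_def split: if_splits)
qed

text \<open>Ranks are invariant under a common translation, so Y lowered by the least initial gap
  \<open>c\<close> is again a solution path and starts above X. Weak comparison then keeps the whole
  gap \<open>c\<close> at all times. As the argument concerns a single path, \<open>c\<close> may
  depend on the sample point.\<close>

lemma rank_path_less:
  fixes w v X Y :: "real \<Rightarrow> real ^ 'n"
  assumes a: "mono_on {1..CARD('n)} a"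
    and w: "lipschitz_avoiding w" "lipschitz_avoiding v" "\<And>t. 0 \<le> t \<Longrightarrow> w t - v t = w 0 - v 0"
    and X: "rank_path a w X" and Y: "rank_path a v Y" and "0 \<le> t"
    and less: "\<And>i. X 0 $ i < Y 0 $ i"
  shows "X t $ i < Y t $ i"
proof -
  define c where "c = Min (range (\<lambda>i. Y 0 $ i - X 0 $ i))"
  have "0 < c"
    unfolding c_def using less by (subst Min_gr_iff) auto
  let ?c = "\<chi> i. c"
  have "X t $ i \<le> (Y t - ?c) $ i"
  proof (rule rank_path_le[OF a w(1) _ _ X])
    show "lipschitz_avoiding (\<lambda>t. v t - ?c)"
      using w(2) by (simp add: lipschitz_avoiding_def)
    show "rank_path a (\<lambda>t. v t - ?c) (\<lambda>t. Y t - ?c)"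
      using Y by (simp add: rank_path_def particle_rank_def)
    show "w t - (v t - ?c) = w 0 - (v 0 - ?c)" if "0 \<le> t" for t
      using w(3)[OF that] by (simp add: algebra_simps)
    show "X 0 $ i \<le> (Y 0 - ?c) $ i" for i
    proof -
      have "c \<le> Y 0 $ i - X 0 $ i"
        unfolding c_def by (intro Min_le) auto
      then show ?thesis by simp
    qed
  qed fact
  with \<open>0 < c\<close> show ?thesis by simp
qed

section \<open>The Euler scheme\<close>

text \<open>Explicit Euler scheme of step \<open>h\<close>: \<open>euler_drift\<close> is the accumulated drift at time \<open>k h\<close> and
  \<open>euler\<close> the position there. Ties are broken by \<open>tie_rank\<close>, so the scheme is dissipative for every path \<open>w\<close>.\<close>

primrec euler_drift :: "(nat \<Rightarrow> real) \<Rightarrow> (real \<Rightarrow> real ^ 'n) \<Rightarrow> real \<Rightarrow> nat \<Rightarrow> real ^ 'n" where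
  "euler_drift a w h 0 = 0"
| "euler_drift a w h (Suc k) =
     euler_drift a w h k + h *\<^sub>R (\<chi> i. a (tie_rank (w (real k * h) - euler_drift a w h k) i))"

definition euler :: "(nat \<Rightarrow> real) \<Rightarrow> (real \<Rightarrow> real ^ 'n) \<Rightarrow> real \<Rightarrow> nat \<Rightarrow> real ^ 'n" where
  "euler a w h k = w (real k * h) - euler_drift a w h k"

text \<open>Only the drift is interpolated linearly; \<open>w\<close> is kept exact. The scheme is
  thus \<open>w t - euler_interp a w h t\<close>, and \<open>w\<close> cancels in the difference of
  two schemes with different steps.\<close>

definition euler_interp :: "(nat \<Rightarrow> real) \<Rightarrow> (real \<Rightarrow> real ^ 'n) \<Rightarrow> real \<Rightarrow> real \<Rightarrow> real ^ 'n" where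
  "euler_interp a w h t = (let k = nat \<lfloor>t / h\<rfloor> in
     euler_drift a w h k + (t - real k * h) *\<^sub>R (\<chi> i. a (tie_rank (euler a w h k) i)))"

lemma nat_floor_divide:
  assumes "0 < h" "real k * h \<le> t" "t < real (Suc k) * h"
  shows "nat \<lfloor>t / h\<rfloor> = k"
proof -
  have "real k \<le> t / h" "t / h < real k + 1"
    using assms by (simp_all add: field_simps)
  then have "\<lfloor>t / h\<rfloor> = int k" by (intro floor_unique) auto
  then show ?thesis by simp
qed

lemma nat_floor_divide_bounds:
  assumes "0 < h" "0 \<le> t"
  shows "real (nat \<lfloor>t / h\<rfloor>) * h \<le> t" "t < real (Suc (nat \<lfloor>t / h\<rfloor>)) * h"
proof -
  have "real (nat \<lfloor>t / h\<rfloor>) \<le> t / h" "t / h < real (Suc (nat \<lfloor>t / h\<rfloor>))"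
    using assms by (auto simp: of_nat_nat) linarith
  then show "real (nat \<lfloor>t / h\<rfloor>) * h \<le> t" "t < real (Suc (nat \<lfloor>t / h\<rfloor>)) * h"
    using assms(1) by (simp_all add: field_simps)
qed

lemma measurable_nat_floor_divide:
  "(\<lambda>t::real. nat \<lfloor>t / h\<rfloor>) \<in> measurable borel (count_space UNIV)"
  by measurable

lemma euler_integrable:
  fixes w :: "real \<Rightarrow> real ^ 'n"
  shows "set_integrable lborel {s..t} (\<lambda>r. a (tie_rank (euler a w h (nat \<lfloor>r / h\<rfloor>)) i))"
proof -
  obtain K where K: "\<And>k. k \<in> {1..CARD('n)} \<Longrightarrow> \<bar>a k\<bar> \<le> K"
    using rank_bound[where 'n = 'n and a = a] by blast
  have "(\<lambda>r. a (tie_rank (euler a w h (nat \<lfloor>r / h\<rfloor>)) i)) \<in> borel_measurable borel"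
    by (rule measurable_compose[OF measurable_nat_floor_divide]) simp
  then show ?thesis
    using K[OF tie_rank_bounds] 
    by (intro set_integrable_Icc_bounded) (auto simp: set_borel_measurable_def)
qed

lemma euler_interp_eq_integral:
  fixes w :: "real \<Rightarrow> real ^ 'n"
  assumes h: "0 < h" and "0 \<le> t"
  shows "euler_interp a w h t $ i = (LINT s:{0..t}|lborel. a (tie_rank (euler a w h (nat \<lfloor>s / h\<rfloor>)) i))"
proof -
  let ?f = "\<lambda>s. a (tie_rank (euler a w h (nat \<lfloor>s / h\<rfloor>)) i)"
  have piece: "(LINT s:{real k * h..t}|lborel. ?f s) = (t - real k * h) * a (tie_rank (euler a w h k) i)"
    if "real k * h \<le> t" "t \<le> real (Suc k) * h" for k t
  proof -
    have "(LINT s:{real k * h..t}|lborel. ?f s) =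
        (LINT s:{real k * h..t}|lborel. a (tie_rank (euler a w h k) i))"
      unfolding set_lebesgue_integral_def
    proof (rule integral_cong_AE)
      show "AE s in lborel. indicator {real k * h..t} s *\<^sub>R ?f s =
          indicator {real k * h..t} s *\<^sub>R a (tie_rank (euler a w h k) i)"
        \<comment> \<open>At the right endpoint the floor may already be \<open>k + 1\<close>; this
          single time is negligible.\<close>
        using AE_lborel_singleton[of t]
      proof eventually_elim
        case (elim s)
        then show ?case
          using that nat_floor_divide[OF h, of k s] by (auto simp: indicator_def)
      qed
    qed (use euler_integrable[of "real k * h" t a w h i] in \<open>auto simp: set_integrable_def\<close>)
    then show ?thesis
      using that by (simp add: set_lebesgue_integral_def)
  qed
  have grid: "euler_drift a w h k $ i = (LINT s:{0..real k * h}|lborel. ?f s)" for k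
  proof (induction k)
    case 0
    show ?case by (simp add: set_integral_Icc_same[of 0, simplified])
  next
    case (Suc k)
    have "(LINT s:{0..real (Suc k) * h}|lborel. ?f s) =
        (LINT s:{0..real k * h}|lborel. ?f s) + (LINT s:{real k * h..real (Suc k) * h}|lborel. ?f s)"
      using h by (intro set_integral_Icc_combine euler_integrable) (auto simp: algebra_simps)
    also have "\<dots> = euler_drift a w h k $ i + h * a (tie_rank (euler a w h k) i)"
      using h by (subst piece) (auto simp: Suc algebra_simps)
    finally show ?case by (simp add: euler_def)
  qed
  define k where "k = nat \<lfloor>t / h\<rfloor>"
  note k = nat_floor_divide_bounds[OF assms, folded k_def]
  have "(LINT s:{0..t}|lborel. ?f s) =
      (LINT s:{0..real k * h}|lborel. ?f s) + (LINT s:{real k * h..t}|lborel. ?f s)"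
    using h k by (intro set_integral_Icc_combine euler_integrable) auto
  also have "\<dots> = euler_interp a w h t $ i"
    using k by (subst piece) (auto simp: grid euler_interp_def Let_def k_def)
  finally show ?thesis by simp
qed

lemma euler_interp_diff:
  "(w t - euler_interp a w h t) - euler a w h (nat \<lfloor>t / h\<rfloor>) =
     (w t - w (real (nat \<lfloor>t / h\<rfloor>) * h)) -
     (t - real (nat \<lfloor>t / h\<rfloor>) * h) *\<^sub>R (\<chi> i. a (tie_rank (euler a w h (nat \<lfloor>t / h\<rfloor>)) i))"
  by (simp add: euler_interp_def euler_def Let_def)

text \<open>Within one step, \<open>w\<close> moves by at most its modulus of continuity on a
  compact interval and the drift by at most K h. The grid position, whose ranks drive the scheme,
  may thus stand in for the current position.\<close>

lemma euler_uniformly_close: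
  fixes w :: "real \<Rightarrow> real ^ 'n"
  assumes w: "continuous_on {0..} w" and "0 < \<epsilon>"
  shows "\<exists>N0. \<forall>N\<ge>N0. \<forall>s\<in>{0..t}. \<forall>i.
    \<bar>(w s - euler_interp a w (1 / real (Suc N)) s) $ i - euler a w (1 / real (Suc N)) (nat \<lfloor>s / (1 / real (Suc N))\<rfloor>) $ i\<bar> \<le> \<epsilon>"
proof -
  obtain K where K: "0 \<le> K" "\<And>k. k \<in> {1..CARD('n)} \<Longrightarrow> \<bar>a k\<bar> \<le> K"
    using rank_bound[where 'n = 'n and a = a] by blast
  have "uniformly_continuous_on {0..t} w"
    by (intro compact_uniformly_continuous continuous_on_subset[OF w]) auto
  then obtain \<delta> where \<delta>: "0 < \<delta>" "\<And>u v. u \<in> {0..t} \<Longrightarrow> v \<in> {0..t} \<Longrightarrow> dist v u < \<delta> \<Longrightarrow> dist (w v) (w u) < \<epsilon> / 2"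
    using \<open>0 < \<epsilon>\<close> unfolding uniformly_continuous_on_def by (metis half_gt_zero)
  \<comment> \<open>Each of the two errors is given \<epsilon> / 2; \<open>K + 1\<close> instead of
    \<open>K\<close> covers the case K = 0.\<close>
  have "0 < min \<delta> (\<epsilon> / (2 * (K + 1)))"
    using \<delta>(1) \<open>0 < \<epsilon>\<close> K(1) by simp
  then obtain N0 where N0: "1 / real (Suc N0) < min \<delta> (\<epsilon> / (2 * (K + 1)))"
    using nat_approx_posE by blast
  show ?thesis
  proof (intro exI allI impI ballI)
    fix N s i assume "N0 \<le> N" and s: "s \<in> {0..t}"
    define h where "h = 1 / real (Suc N)"
    have "h \<le> 1 / real (Suc N0)"
      using \<open>N0 \<le> N\<close> by (simp add: h_def frac_le)
    with N0 have h: "0 < h" "h < \<delta>" "h < \<epsilon> / (2 * (K + 1))"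
      by (auto simp: h_def)
    define k where "k = nat \<lfloor>s / h\<rfloor>"
    have k: "real k * h \<le> s" "s < real (Suc k) * h" "0 \<le> real k * h"
      using nat_floor_divide_bounds[of h s] h s by (auto simp: k_def)
    have sk: "0 \<le> s - real k * h" "s - real k * h < h"
      using k by (auto simp: algebra_simps)
    have "\<bar>(w s - w (real k * h)) $ i\<bar> \<le> dist (w s) (w (real k * h))"
      unfolding dist_norm by (rule component_le_norm_cart)
    also have "\<dots> < \<epsilon> / 2"
      using \<delta>(2)[of "real k * h" s] s k sk h by (auto simp: dist_real_def)
    finally have "\<bar>(w s - w (real k * h)) $ i\<bar> < \<epsilon> / 2" .
    moreover have "\<bar>(s - real k * h) * a (tie_rank (euler a w h k) i)\<bar> \<le> h * K"
      unfolding abs_mult using K(2)[OF tie_rank_bounds] sk by (intro mult_mono) auto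
    moreover have "h * K \<le> \<epsilon> / 2"
    proof -
      have "h * (2 * (K + 1)) < \<epsilon>"
        using h(3) K(1) by (simp add: pos_less_divide_eq)
      then show ?thesis using h(1) by (simp add: algebra_simps)
    qed
    moreover have "(w s - euler_interp a w h s) $ i - euler a w h k $ i =
        (w s - w (real k * h)) $ i - (s - real k * h) * a (tie_rank (euler a w h k) i)"
      using arg_cong[OF euler_interp_diff[of w s a h], of "\<lambda>x. x $ i"] by (simp add: k_def)
    ultimately have "\<bar>(w s - euler_interp a w h s) $ i - euler a w h k $ i\<bar> \<le> \<epsilon>"
      by linarith
    then show "\<bar>(w s - euler_interp a w (1 / real (Suc N)) s) $ i - euler a w (1 / real (Suc N)) (nat \<lfloor>s / (1 / real (Suc N))\<rfloor>) $ i\<bar> \<le> \<epsilon>"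
      by (simp only: h_def k_def)
  qed
qed

text \<open>For two steps, \<open>V M - V N\<close> differs from the difference
  \<open>E N - E M\<close> of grid positions by at most 2 \<epsilon>. With the latter as weights,
  the rearrangement inequality makes the drift dissipative, so the squared distance of the two
  schemes grows at a rate of order \<epsilon> only.\<close>

lemma euler_convergent:
  fixes w :: "real \<Rightarrow> real ^ 'n"
  assumes a: "mono_on {1..CARD('n)} a" and w: "continuous_on {0..} w" and "0 \<le> t"
  shows "convergent (\<lambda>N. euler_interp a w (1 / real (Suc N)) t $ i)"
proof (rule real_Cauchy_convergent, rule metric_CauchyI)
  fix e :: real assume "0 < e"
  obtain K where K: "0 \<le> K" "\<And>k. k \<in> {1..CARD('n)} \<Longrightarrow> \<bar>a k\<bar> \<le> K"
    using rank_bound[where 'n = 'n and a = a] by blast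
  let ?n = "real CARD('n)"
  \<comment> \<open>Replacing the weights costs at most
    \<open>2 * (\<epsilon> + \<epsilon>) * (K + K)\<close> per particle, which is the source of the
    factor 8. Adding 1 keeps the denominator positive and makes the final bound strict.\<close>
  define \<epsilon> where "\<epsilon> = e\<^sup>2 / (8 * ?n * K * t + 1)"
  have pos: "0 < 8 * ?n * K * t + 1"
    using K(1) \<open>0 \<le> t\<close> by (intro add_nonneg_pos mult_nonneg_nonneg) auto
  have "0 < \<epsilon>"
    using \<open>0 < e\<close> pos by (simp add: \<epsilon>_def)
  define V where "V N = euler_interp a w (1 / real (Suc N))" for N
  define E where "E N s = euler a w (1 / real (Suc N)) (nat \<lfloor>s / (1 / real (Suc N))\<rfloor>)" for N s
  have V: "V N s $ i = (LINT r:{0..s}|lborel. a (tie_rank (E N r) i))" if "0 \<le> s" for N s i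
    unfolding V_def E_def using that by (intro euler_interp_eq_integral) auto
  have V0: "V N 0 $ i = 0" for N i
    by (simp add: V set_integral_Icc_same[of 0, simplified])
  have int: "set_integrable lborel {0..s} (\<lambda>r. a (tie_rank (E N r) i))" for N s i
    unfolding E_def by (rule euler_integrable)
  obtain N0 where N0: "\<And>N s i. N0 \<le> N \<Longrightarrow> s \<in> {0..t} \<Longrightarrow> \<bar>(w s - V N s) $ i - E N s $ i\<bar> \<le> \<epsilon>"
    using euler_uniformly_close[OF w \<open>0 < \<epsilon>\<close>, of t a] unfolding V_def E_def by blast
  show "\<exists>N0. \<forall>N\<ge>N0. \<forall>M\<ge>N0. dist (euler_interp a w (1 / real (Suc N)) t $ i) (euler_interp a w (1 / real (Suc M)) t $ i) < e"
  proof (intro exI allI impI)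
    fix N M assume NM: "N0 \<le> N" "N0 \<le> M"
    let ?\<gamma> = "\<lambda>s i. a (tie_rank (E M s) i) - a (tie_rank (E N s) i)"
    have "(\<Sum>i\<in>UNIV. (V M t $ i - V N t $ i)\<^sup>2) \<le> (\<Sum>i\<in>UNIV. (V M 0 $ i - V N 0 $ i)\<^sup>2) + (8 * ?n * K * \<epsilon>) * t"
    proof (rule energy_le[where D = "\<lambda>t i. V M t $ i - V N t $ i" and \<gamma> = ?\<gamma> and K = "K + K" and \<eta> = "\<lambda>x. 2 * x" and \<psi> = "\<lambda>x. x\<^sup>2", OF \<open>0 \<le> t\<close>])
      show "V M s $ i - V N s $ i = V M 0 $ i - V N 0 $ i + (LINT s:{0..s}|lborel. ?\<gamma> s i)" if "0 \<le> s" for s i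
        using that int by (simp add: V V0)
      show "set_integrable lborel {0..t} (\<lambda>s. ?\<gamma> s i)" for i
        using int by auto
      show bound: "\<bar>?\<gamma> s i\<bar> \<le> K + K" for s i
        using K(2)[OF tie_rank_bounds] by (intro order_trans[OF abs_triangle_ineq4] add_mono)
      show "AE s in lborel. s \<in> {0..t} \<longrightarrow> (\<Sum>i\<in>UNIV. 2 * (V M s $ i - V N s $ i) * ?\<gamma> s i) \<le> 8 * ?n * K * \<epsilon>"
      proof (intro AE_I2 impI)
        fix s assume s: "s \<in> {0..t}"
        have "(\<Sum>i\<in>UNIV. 2 * (V M s $ i - V N s $ i) * ?\<gamma> s i) \<le>
            (\<Sum>i\<in>UNIV. 2 * (E N s $ i - E M s $ i) * ?\<gamma> s i + 8 * K * \<epsilon>)"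
        proof (rule sum_mono)
          fix i
          have "\<bar>(V M s $ i - V N s $ i) - (E N s $ i - E M s $ i)\<bar> \<le> \<epsilon> + \<epsilon>"
            using N0[OF NM(1) s, of i] N0[OF NM(2) s, of i] by simp
          then have "\<bar>((V M s $ i - V N s $ i) - (E N s $ i - E M s $ i)) * ?\<gamma> s i\<bar> \<le> (\<epsilon> + \<epsilon>) * (K + K)"
            unfolding abs_mult using \<open>0 < \<epsilon>\<close> by (intro mult_mono bound) auto
          then have "((V M s $ i - V N s $ i) - (E N s $ i - E M s $ i)) * ?\<gamma> s i \<le> (\<epsilon> + \<epsilon>) * (K + K)"
            by simp
          then show "2 * (V M s $ i - V N s $ i) * ?\<gamma> s i \<le> 2 * (E N s $ i - E M s $ i) * ?\<gamma> s i + 8 * K * \<epsilon>"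
            unfolding left_diff_distrib[of "V M s $ i - V N s $ i"] by (simp add: algebra_simps)
        qed
        also have "\<dots> = 2 * ((\<Sum>i\<in>UNIV. (E N s $ i - E M s $ i) * a (tie_rank (E M s) i)) -
            (\<Sum>i\<in>UNIV. (E N s $ i - E M s $ i) * a (tie_rank (E N s) i))) + 8 * ?n * K * \<epsilon>"
        proof -
          have "(\<Sum>i\<in>UNIV. 2 * (E N s $ i - E M s $ i) * ?\<gamma> s i) =
              2 * ((\<Sum>i\<in>UNIV. (E N s $ i - E M s $ i) * a (tie_rank (E M s) i)) -
                (\<Sum>i\<in>UNIV. (E N s $ i - E M s $ i) * a (tie_rank (E N s) i)))"
            unfolding sum_subtractf[symmetric] sum_distrib_left
            by (intro sum.cong refl) (simp add: algebra_simps)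
          then show ?thesis
            unfolding sum.distrib by simp
        qed
        also have "\<dots> \<le> 8 * ?n * K * \<epsilon>"
          using sum_weighted_rank_mono[OF a, of "E N s" "E M s" "\<lambda>i. E N s $ i - E M s $ i"] by simp
        finally show "(\<Sum>i\<in>UNIV. 2 * (V M s $ i - V N s $ i) * ?\<gamma> s i) \<le> 8 * ?n * K * \<epsilon>" .
      qed
    qed (auto simp: power2_eq_square algebra_simps abs_if)
    also have "\<dots> = (8 * ?n * K * t) * \<epsilon>"
      by (simp add: V0)
    also have "\<dots> < (8 * ?n * K * t + 1) * \<epsilon>"
      using \<open>0 < \<epsilon>\<close> by (simp add: algebra_simps)
    also have "\<dots> = e\<^sup>2"
      using pos by (simp add: \<epsilon>_def)
    finally have "(\<Sum>i\<in>UNIV. (V M t $ i - V N t $ i)\<^sup>2) < e\<^sup>2" .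
    moreover have "(V M t $ i - V N t $ i)\<^sup>2 \<le> (\<Sum>i\<in>UNIV. (V M t $ i - V N t $ i)\<^sup>2)"
      by (rule member_le_sum) auto
    ultimately have "(V M t $ i - V N t $ i)\<^sup>2 < e\<^sup>2" by linarith
    then have "\<bar>V M t $ i - V N t $ i\<bar> < e"
      using \<open>0 < e\<close> power_less_imp_less_base[of "\<bar>V M t $ i - V N t $ i\<bar>" 2 e] by simp
    then show "dist (euler_interp a w (1 / real (Suc N)) t $ i) (euler_interp a w (1 / real (Suc M)) t $ i) < e"
      by (simp add: V_def dist_real_def abs_minus_commute)
  qed
qed

text \<open>As \<open>lim\<close> is total, this is a function of every path, continuous or not.
  Measurability in the sample point can then be proved without an exceptional set.\<close>

definition euler_limit :: "(nat \<Rightarrow> real) \<Rightarrow> (real \<Rightarrow> real ^ 'n) \<Rightarrow> real \<Rightarrow> real ^ 'n" where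
  "euler_limit a w t = (\<chi> i. lim (\<lambda>N. euler_interp a w (1 / real (Suc N)) t $ i))"

lemma euler_limit_tendsto:
  fixes w :: "real \<Rightarrow> real ^ 'n"
  assumes "mono_on {1..CARD('n)} a" "continuous_on {0..} w" "0 \<le> t"
  shows "(\<lambda>N. euler_interp a w (1 / real (Suc N)) t $ i) \<longlonglongrightarrow> euler_limit a w t $ i"
  using euler_convergent[OF assms] by (simp add: euler_limit_def convergent_LIMSEQ_iff)

lemma euler_limit_lipschitz:
  fixes w :: "real \<Rightarrow> real ^ 'n"
  assumes a: "mono_on {1..CARD('n)} a" and w: "continuous_on {0..} w"
    and K: "0 \<le> K" "\<And>k. k \<in> {1..CARD('n)} \<Longrightarrow> \<bar>a k\<bar> \<le> K"
  shows "K-lipschitz_on {0..} (\<lambda>t. euler_limit a w t $ i)"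
proof (rule lipschitz_onI[OF _ K(1)])
  fix s t :: real assume st: "s \<in> {0..}" "t \<in> {0..}"
  let ?V = "\<lambda>N t. euler_interp a w (1 / real (Suc N)) t $ i"
  have "K-lipschitz_on {0..} (?V N)" for N
  proof (rule lipschitz_on_transform)
    show "K-lipschitz_on {0..} (\<lambda>t. LINT s:{0..t}|lborel.
        a (tie_rank (euler a w (1 / real (Suc N)) (nat \<lfloor>s / (1 / real (Suc N))\<rfloor>)) i))"
      by (intro set_integral_lipschitz_on euler_integrable K tie_rank_bounds)
  qed (simp add: euler_interp_eq_integral)
  then have "dist (?V N s) (?V N t) \<le> K * dist s t" for N
    using st by (rule lipschitz_onD)
  moreover have "(\<lambda>N. dist (?V N s) (?V N t)) \<longlonglongrightarrow> dist (euler_limit a w s $ i) (euler_limit a w t $ i)"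
    using st by (intro tendsto_dist euler_limit_tendsto a w) auto
  ultimately show "dist (euler_limit a w s $ i) (euler_limit a w t $ i) \<le> K * dist s t"
    by (intro LIMSEQ_le_const2) auto
qed

lemma set_borel_measurable_particle_rank:
  fixes X :: "real \<Rightarrow> real ^ 'n"
  assumes "continuous_on {0..} X"
  shows "set_borel_measurable lborel {0..t} (\<lambda>s. a (particle_rank (X s) i) :: real)"
proof -
  have "continuous_on UNIV (\<lambda>s. X (max 0 s))"
    by (intro continuous_on_compose2[OF assms] continuous_intros) auto
  then have "(\<lambda>s. X (max 0 s)) \<in> borel_measurable borel"
    by (rule borel_measurable_continuous_onI)
  then have "(\<lambda>s. a (particle_rank (X (max 0 s)) i)) \<in> borel_measurable borel"
    by (intro measurable_compose[OF measurable_particle_rank]) auto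
  then have "(\<lambda>s. indicator {0..t} s *\<^sub>R a (particle_rank (X (max 0 s)) i)) \<in> borel_measurable lborel"
    by simp
  also have "(\<lambda>s. indicator {0..t} s *\<^sub>R a (particle_rank (X (max 0 s)) i)) =
      (\<lambda>s. indicator {0..t} s *\<^sub>R a (particle_rank (X s) i))"
    by (auto simp: indicator_def fun_eq_iff)
  finally show ?thesis
    unfolding set_borel_measurable_def .
qed

lemma euler_limit_continuous:
  fixes w :: "real \<Rightarrow> real ^ 'n"
  assumes a: "mono_on {1..CARD('n)} a" and w: "continuous_on {0..} w"
  shows "continuous_on {0..} (\<lambda>t. w t - euler_limit a w t)"
proof -
  obtain K where K: "0 \<le> K" "\<And>k. k \<in> {1..CARD('n)} \<Longrightarrow> \<bar>a k\<bar> \<le> K"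
    using rank_bound[where 'n = 'n and a = a] by blast
  have "continuous_on {0..} (\<lambda>t. \<chi> i. euler_limit a w t $ i)"
    using euler_limit_lipschitz[OF a w K]
    by (intro continuous_on_vec_lambda lipschitz_on_continuous_on)
  then show ?thesis
    using w by (intro continuous_intros) simp_all
qed

text \<open>Convergence of the positions does not by itself give convergence of the drifts, since
  ranks jump at ties. But the limiting drift is Lipschitz, so the limit has ties only on a null set
  of times; at every other time the ranks of the scheme are eventually those of the limit, and
  dominated convergence applies with the bound \<open>K\<close>.\<close>

lemma euler_limit_rank_path:
  fixes w :: "real \<Rightarrow> real ^ 'n"
  assumes a: "mono_on {1..CARD('n)} a" and w: "continuous_on {0..} w" "lipschitz_avoiding w"
  shows "rank_path a w (\<lambda>t. w t - euler_limit a w t)"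
  unfolding rank_path_def
proof (intro allI impI)
  fix t :: real and i :: 'n assume "0 \<le> t"
  define X where "X t = w t - euler_limit a w t" for t
  define E where "E N s = euler a w (1 / real (Suc N)) (nat \<lfloor>s / (1 / real (Suc N))\<rfloor>)" for N s
  obtain K where K: "0 \<le> K" "\<And>k. k \<in> {1..CARD('n)} \<Longrightarrow> \<bar>a k\<bar> \<le> K"
    using rank_bound[where 'n = 'n and a = a] by blast
  have meas: "set_borel_measurable lborel {0..t} (\<lambda>s. a (particle_rank (X s) i))"
    unfolding X_def by (intro set_borel_measurable_particle_rank euler_limit_continuous a w)
  have no_ties: "AE s in lborel. 0 \<le> s \<longrightarrow> inj (($) (X s))"
    using euler_limit_lipschitz[OF a w(1) K] by (intro AE_no_ties[OF w(2), of K]) (simp add: X_def)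
  have E_lim: "(\<lambda>N. E N s $ j) \<longlonglongrightarrow> X s $ j" if "0 \<le> s" for s j
  proof -
    have "(\<lambda>N. (w s - euler_interp a w (1 / real (Suc N)) s) $ j - E N s $ j) \<longlonglongrightarrow> 0"
    proof (rule metric_LIMSEQ_I)
      fix r :: real assume "0 < r"
      then obtain N0 where "\<And>N. N0 \<le> N \<Longrightarrow> \<bar>(w s - euler_interp a w (1 / real (Suc N)) s) $ j - E N s $ j\<bar> \<le> r / 2"
        using euler_uniformly_close[OF w(1) half_gt_zero, of r s a] \<open>0 \<le> s\<close> unfolding E_def
        by (metis atLeastAtMost_iff order_refl)
      with \<open>0 < r\<close> show "\<exists>N0. \<forall>N\<ge>N0. dist ((w s - euler_interp a w (1 / real (Suc N)) s) $ j - E N s $ j) 0 < r"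
        by (intro exI[of _ N0]) (fastforce simp: dist_real_def)
    qed
    moreover have "(\<lambda>N. (w s - euler_interp a w (1 / real (Suc N)) s) $ j) \<longlonglongrightarrow> X s $ j"
      unfolding X_def vector_minus_component using that
      by (intro tendsto_intros euler_limit_tendsto a w)
    ultimately show ?thesis
      using tendsto_diff[of "\<lambda>N. (w s - euler_interp a w (1 / real (Suc N)) s) $ j" "X s $ j" sequentially] by fastforce
  qed
  have rank_lim: "(\<lambda>N. a (tie_rank (E N s) i)) \<longlonglongrightarrow> a (particle_rank (X s) i)" if s: "0 \<le> s" "inj (($) (X s))" for s
  proof (rule tendsto_eventually)
    have "\<forall>\<^sub>F N in sequentially. X s $ j < X s $ k \<longrightarrow> E N s $ j < E N s $ k" for j k
    proof (cases "X s $ j < X s $ k")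
      case True
      have "(\<lambda>N. E N s $ k - E N s $ j) \<longlonglongrightarrow> X s $ k - X s $ j"
        by (intro tendsto_diff E_lim s)
      then have "\<forall>\<^sub>F N in sequentially. 0 < E N s $ k - E N s $ j"
        using True by (intro order_tendstoD(1)) auto
      then show ?thesis by eventually_elim simp
    qed simp
    then have "\<forall>\<^sub>F N in sequentially. \<forall>j k. X s $ j < X s $ k \<longrightarrow> E N s $ j < E N s $ k"
      by (intro eventually_all_finite)
    then show "\<forall>\<^sub>F N in sequentially. a (tie_rank (E N s) i) = a (particle_rank (X s) i)"
    proof eventually_elim
      case (elim N)
      then show ?case
        using tie_rank_eqI[OF s(2), of "E N s" i] tie_rank_eq_particle_rank[OF s(2)] by simp
    qed
  qed
  have "set_integrable lborel {0..t} (\<lambda>s. a (particle_rank (X s) i))"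
    using meas K(2)[OF particle_rank_bounds] by (rule set_integrable_Icc_bounded)
  moreover have "(\<lambda>N. LINT s:{0..t}|lborel. a (tie_rank (E N s) i)) \<longlonglongrightarrow> (LINT s:{0..t}|lborel. a (particle_rank (X s) i))"
    unfolding set_lebesgue_integral_def
  proof (rule integral_dominated_convergence[where w = "\<lambda>s. indicator {0..t} s * K"])
    show "(\<lambda>s. indicat_real {0..t} s *\<^sub>R a (particle_rank (X s) i)) \<in> borel_measurable lborel"
      using meas by (simp add: set_borel_measurable_def)
    show "(\<lambda>s. indicat_real {0..t} s *\<^sub>R a (tie_rank (E N s) i)) \<in> borel_measurable lborel" for N
      using euler_integrable[of 0 t a w "1 / real (Suc N)" i] by (simp add: E_def set_integrable_def)
    show "AE s in lborel. (\<lambda>N. indicat_real {0..t} s *\<^sub>R a (tie_rank (E N s) i)) \<longlonglongrightarrow>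
        indicat_real {0..t} s *\<^sub>R a (particle_rank (X s) i)"
      using no_ties
    proof eventually_elim
      case (elim s)
      then show ?case
        using rank_lim[of s] by (cases "s \<in> {0..t}") auto
    qed
    show "AE s in lborel. norm (indicat_real {0..t} s *\<^sub>R a (tie_rank (E N s) i)) \<le> indicat_real {0..t} s * K" for N
      using K(2)[OF tie_rank_bounds] by (intro AE_I2) (auto simp: indicator_def)
  qed (use \<open>0 \<le> t\<close> in simp)
  then have "(\<lambda>N. euler_interp a w (1 / real (Suc N)) t $ i) \<longlonglongrightarrow> (LINT s:{0..t}|lborel. a (particle_rank (X s) i))"
    using \<open>0 \<le> t\<close> by (simp add: euler_interp_eq_integral E_def)
  then have "euler_limit a w t $ i = (LINT s:{0..t}|lborel. a (particle_rank (X s) i))"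
    using euler_limit_tendsto[OF a w(1) \<open>0 \<le> t\<close>] by (rule LIMSEQ_unique[rotated])
  ultimately show "set_integrable lborel {0..t} (\<lambda>s. a (particle_rank (w s - euler_limit a w s) i)) \<and>
      (w t - euler_limit a w t) $ i = w t $ i - (LINT s:{0..t}|lborel. a (particle_rank (w s - euler_limit a w s) i))"
    by (simp add: X_def)
qed

section \<open>Measurability of the scheme in the sample point\<close>

lemma borel_measurable_vec_lambda:
  fixes f :: "'a \<Rightarrow> 'n :: finite \<Rightarrow> real"
  assumes "\<And>i. (\<lambda>\<omega>. f \<omega> i) \<in> borel_measurable N"
  shows "(\<lambda>\<omega>. \<chi> i. f \<omega> i) \<in> borel_measurable N"
  by (subst borel_measurable_euclidean_space) (use assms in \<open>auto simp: Basis_vec_def inner_axis\<close>)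

lemma measurable_tie_drift:
  fixes f :: "'a \<Rightarrow> real ^ 'n"
  assumes [measurable]: "f \<in> borel_measurable N"
  shows "(\<lambda>\<omega>. \<chi> i. (a (tie_rank (f \<omega>) i) :: real)) \<in> borel_measurable N"
  by (intro borel_measurable_vec_lambda measurable_compose[OF measurable_tie_rank]) auto

text \<open>The accumulated drift at time k h reads \<open>w\<close> only at earlier grid times.
  \<open>N\<close> is left arbitrary so that it can be the sigma-algebra of time t, which yields
  adaptedness.\<close>

lemma measurable_euler_drift:
  fixes w :: "'a \<Rightarrow> real \<Rightarrow> real ^ 'n"
  assumes w: "\<And>s. 0 \<le> s \<Longrightarrow> s \<le> t \<Longrightarrow> (\<lambda>\<omega>. w \<omega> s) \<in> borel_measurable N"
    and "0 \<le> h" "real k * h \<le> t"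
  shows "(\<lambda>\<omega>. euler_drift a (w \<omega>) h k) \<in> borel_measurable N"
  using assms(3)
proof (induction k)
  case (Suc k)
  then have k: "real k * h \<le> t"
    using \<open>0 \<le> h\<close> by (simp add: algebra_simps)
  have [measurable]: "(\<lambda>\<omega>. w \<omega> (real k * h)) \<in> borel_measurable N"
    using k \<open>0 \<le> h\<close> by (intro w) auto
  have [measurable]: "(\<lambda>\<omega>. euler_drift a (w \<omega>) h k) \<in> borel_measurable N"
    using k by (rule Suc.IH)
  show ?case
    unfolding euler_drift.simps
    by (intro borel_measurable_add borel_measurable_scaleR measurable_tie_drift) measurable
qed simp

lemma measurable_euler_interp:
  fixes w :: "'a \<Rightarrow> real \<Rightarrow> real ^ 'n"
  assumes w: "\<And>s. 0 \<le> s \<Longrightarrow> s \<le> t \<Longrightarrow> (\<lambda>\<omega>. w \<omega> s) \<in> borel_measurable N"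
    and h: "0 < h" and "0 \<le> t"
  shows "(\<lambda>\<omega>. euler_interp a (w \<omega>) h t) \<in> borel_measurable N"
proof -
  define k where "k = nat \<lfloor>t / h\<rfloor>"
  have k: "real k * h \<le> t"
    using nat_floor_divide_bounds(1)[OF h \<open>0 \<le> t\<close>] by (simp add: k_def)
  have [measurable]: "(\<lambda>\<omega>. w \<omega> (real k * h)) \<in> borel_measurable N"
    using k h by (intro w) auto
  have [measurable]: "(\<lambda>\<omega>. euler_drift a (w \<omega>) h k) \<in> borel_measurable N"
    using k h by (intro measurable_euler_drift[where t = t] w) auto
  show ?thesis
    unfolding euler_interp_def Let_def k_def[symmetric] euler_def
    by (intro borel_measurable_add borel_measurable_scaleR measurable_tie_drift) measurable
qed

lemma measurable_euler_limit:
  fixes w :: "'a \<Rightarrow> real \<Rightarrow> real ^ 'n"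
  assumes w: "\<And>s. 0 \<le> s \<Longrightarrow> s \<le> t \<Longrightarrow> (\<lambda>\<omega>. w \<omega> s) \<in> borel_measurable N" and "0 \<le> t"
  shows "(\<lambda>\<omega>. euler_limit a (w \<omega>) t) \<in> borel_measurable N"
  unfolding euler_limit_def
  by (intro borel_measurable_vec_lambda borel_measurable_lim_metric borel_measurable_vec_nth_compose
      measurable_euler_interp w \<open>0 \<le> t\<close>) auto

section \<open>Brownian paths against Lipschitz functions\<close>

text \<open>Joint measurability is what Fubini requires below. Rounding the time down to a multiple
  of \<open>1 / real (Suc n)\<close> leaves countably many times, and continuity recovers the
  process in the limit.\<close>

lemma borel_measurable_continuous_paths:
  fixes W :: "real \<Rightarrow> 'a \<Rightarrow> real"
  assumes meas: "\<And>t. W t \<in> borel_measurable M"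
    and cont: "\<And>\<omega>. \<omega> \<in> space M \<Longrightarrow> continuous_on UNIV (\<lambda>t. W t \<omega>)"
  shows "(\<lambda>(t, \<omega>). W t \<omega>) \<in> borel_measurable (lborel \<Otimes>\<^sub>M M)"
proof (rule borel_measurable_LIMSEQ_metric)
  fix n :: nat
  show "(\<lambda>x. W (of_int \<lfloor>real (Suc n) * fst x\<rfloor> / real (Suc n)) (snd x)) \<in> borel_measurable (lborel \<Otimes>\<^sub>M M)"
  proof (rule measurable_compose_countable[where g = "\<lambda>x. \<lfloor>real (Suc n) * fst x\<rfloor>"])
    show "(\<lambda>x. W (of_int i / real (Suc n)) (snd x)) \<in> borel_measurable (lborel \<Otimes>\<^sub>M M)" for i
      using meas by measurable
  qed measurable
next
  fix x :: "real \<times> 'a" assume "x \<in> space (lborel \<Otimes>\<^sub>M M)"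
  then have \<omega>: "snd x \<in> space M" by (auto simp: space_pair_measure)
  have "(\<lambda>n. of_int \<lfloor>real (Suc n) * fst x\<rfloor> / real (Suc n)) \<longlonglongrightarrow> fst x"
  proof (rule LIMSEQ_I)
    fix r :: real assume "0 < r"
    then obtain N where N: "1 / real (Suc N) < r"
      using nat_approx_posE by blast
    have "norm (of_int \<lfloor>real (Suc n) * fst x\<rfloor> / real (Suc n) - fst x) < r" if "N \<le> n" for n
    proof -
      have "\<bar>of_int \<lfloor>real (Suc n) * fst x\<rfloor> - real (Suc n) * fst x\<bar> \<le> 1"
        by linarith
      then have "\<bar>of_int \<lfloor>real (Suc n) * fst x\<rfloor> - real (Suc n) * fst x\<bar> / real (Suc n) \<le> 1 / real (Suc n)"
        by (rule divide_right_mono) simp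
      also have "\<dots> \<le> 1 / real (Suc N)"
        using that by (simp add: frac_le)
      finally have "\<bar>of_int \<lfloor>real (Suc n) * fst x\<rfloor> - real (Suc n) * fst x\<bar> / real (Suc n) < r"
        using N by simp
      moreover have "of_int \<lfloor>real (Suc n) * fst x\<rfloor> / real (Suc n) - fst x =
          (of_int \<lfloor>real (Suc n) * fst x\<rfloor> - real (Suc n) * fst x) / real (Suc n)"
        by (simp add: diff_divide_distrib)
      ultimately show ?thesis by (simp add: abs_divide)
    qed
    then show "\<exists>N. \<forall>n\<ge>N. norm (of_int \<lfloor>real (Suc n) * fst x\<rfloor> / real (Suc n) - fst x) < r" by blast
  qed
  then have "(\<lambda>n. W (of_int \<lfloor>real (Suc n) * fst x\<rfloor> / real (Suc n)) (snd x)) \<longlonglongrightarrow> W (fst x) (snd x)"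
    using continuous_on_tendsto_compose[OF cont[OF \<omega>]] by simp
  then show "(\<lambda>n. W (of_int \<lfloor>real (Suc n) * fst x\<rfloor> / real (Suc n)) (snd x)) \<longlonglongrightarrow> (case x of (t, \<omega>) \<Rightarrow> W t \<omega>)"
    by (simp add: case_prod_beta)
qed

text \<open>If \<open>g = f\<close> on a compact set of positive measure, then for small \<open>h\<close> this set meets its translate by
  \<open>h\<close> in at least half of its measure, and there \<open>g\<close> moves by at most \<open>L h\<close>.\<close>

lemma AE_not_lipschitz:
  fixes g f :: "real \<Rightarrow> real"
  assumes g: "continuous_on UNIV g" and f: "L-lipschitz_on {0..} f"
    and h: "\<And>k. 0 < h k" "h \<longlonglongrightarrow> 0"
    and lim: "\<And>n::nat. liminf (\<lambda>k. emeasure lborel {s \<in> {0..real n}. \<bar>g (s + h k) - g s\<bar> \<le> real n * h k}) = 0"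
  shows "AE s in lborel. 0 \<le> s \<longrightarrow> g s \<noteq> f s"
proof -
  \<comment> \<open>The single integer \<open>n\<close> bounds both the time horizon and the
    Lipschitz constant, so the countable family of assumptions \<open>lim\<close> covers every
    \<open>L\<close> and every time.\<close>
  have null: "{s \<in> {0..real n}. g s = f s} \<in> null_sets lborel" if n: "L \<le> real n" for n
  proof (rule ccontr)
    define E where "E = {s \<in> {0..real n}. g s = f s}"
    have "E = {s \<in> {0..real n}. g s - f s = 0}"
      by (auto simp: E_def)
    also have "closed \<dots>"
      by (intro continuous_closed_preimage_constant continuous_on_diff
          continuous_on_subset[OF g] continuous_on_subset[OF lipschitz_on_continuous_on[OF f]]) auto
    finally have closed: "closed E" .
    have "bounded E"
      by (rule bounded_subset[of "{0..real n}"]) (auto simp: E_def)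
    with closed have "compact E"
      by (simp add: compact_eq_bounded_closed)
    then have fin: "emeasure lborel E < \<infinity>"
      by (rule emeasure_compact_finite)
    assume "\<not> ?thesis"
    then have "E \<notin> null_sets lborel"
      by (simp add: E_def)
    then have "emeasure lborel E \<noteq> 0"
      using closed by (auto simp: null_sets_def)
    then obtain m where m: "0 < m" "emeasure lborel E = ennreal m"
      using fin by (metis ennreal_cases ennreal_eq_0_iff infinity_ennreal_def not_le order_less_irrefl top.not_eq_extremum)
    \<comment> \<open>Short translations keep E inside the neighbourhood U. Points of E that leave E
      are therefore carried into \<open>U - E\<close>, so they have measure less than m / 2.\<close>
    obtain U where U: "open U" "E \<subseteq> U" "emeasure lborel (U - E) < ennreal (m / 2)"
      using outer_regular_lborel[of E "m / 2"] closed m by auto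
    obtain \<epsilon> where \<epsilon>: "0 < \<epsilon>" "(\<Union>x\<in>E. ball x \<epsilon>) \<subseteq> U"
      using compact_subset_open_imp_ball_epsilon_subset[OF \<open>compact E\<close> U(1,2)] by blast
    have large: "ennreal (m / 2) \<le> emeasure lborel {s \<in> {0..real n}. \<bar>g (s + r) - g s\<bar> \<le> real n * r}"
      if r: "0 < r" "r < \<epsilon>" for r
    proof -
      let ?F = "{s \<in> {0..real n}. \<bar>g (s + r) - g s\<bar> \<le> real n * r}"
      have "closed ({0..real n} \<inter> {s. \<bar>g (s + r) - g s\<bar> \<le> real n * r})"
        by (intro closed_Int closed_Collect_le continuous_intros continuous_on_compose2[OF g] g) auto
      also have "{0..real n} \<inter> {s. \<bar>g (s + r) - g s\<bar> \<le> real n * r} = ?F"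
        by auto
      finally have "closed ?F" .
      have "E \<subseteq> ?F \<union> (+) r -` (U - E)"
      proof
        fix s assume s: "s \<in> E"
        show "s \<in> ?F \<union> (+) r -` (U - E)"
        proof (cases "s + r \<in> E")
          case True
          then have "\<bar>g (s + r) - g s\<bar> = dist (f (s + r)) (f s)"
            using s by (simp add: E_def dist_real_def)
          also have "\<dots> \<le> L * dist (s + r) s"
            using s r by (intro lipschitz_onD[OF f]) (auto simp: E_def)
          also have "\<dots> \<le> real n * r"
            using n r by (simp add: dist_real_def mult_right_mono)
          finally show ?thesis using s by (simp add: E_def)
        next
          case False
          have "s + r \<in> ball s \<epsilon>" using r by (simp add: dist_real_def)
          with \<epsilon>(2) s have "s + r \<in> U" by blast
          with False show ?thesis by (simp add: add.commute)
        qed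
      qed
      then have "emeasure lborel E \<le> emeasure lborel (?F \<union> (+) r -` (U - E))"
        using \<open>closed ?F\<close> closed U(1) by (intro emeasure_mono) (auto intro!: measurable_sets_borel[of _ borel])
      also have "\<dots> \<le> emeasure lborel ?F + emeasure lborel ((+) r -` (U - E))"
        using \<open>closed ?F\<close> closed U(1) by (intro emeasure_subadditive) (auto intro!: measurable_sets_borel[of _ borel])
      also have "emeasure lborel ((+) r -` (U - E)) = emeasure (distr lborel borel ((+) r)) (U - E)"
        using closed U(1) by (subst emeasure_distr) auto
      also have "\<dots> \<le> ennreal (m / 2)"
        using U(3) by (simp add: lborel_distr_plus)
      finally have "ennreal m \<le> emeasure lborel ?F + ennreal (m / 2)"
        using m by (simp add: add_left_mono)
      moreover have "ennreal m = ennreal (m / 2) + ennreal (m / 2)"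
        using m(1) by (simp flip: ennreal_plus)
      ultimately show ?thesis
        using ennreal_add_left_cancel_le[of "ennreal (m / 2)"] by (simp add: add.commute)
    qed
    have "\<forall>\<^sub>F k in sequentially. h k < \<epsilon>"
      using h(2) \<epsilon>(1) by (rule order_tendstoD(2))
    then have "\<forall>\<^sub>F k in sequentially. ennreal (m / 2) \<le> emeasure lborel {s \<in> {0..real n}. \<bar>g (s + h k) - g s\<bar> \<le> real n * h k}"
      by eventually_elim (rule large[OF h(1)])
    then have "ennreal (m / 2) \<le> 0"
      unfolding lim[of n, symmetric] by (rule Liminf_bounded)
    with m(1) show False by simp
  qed
  have "AE s in lborel. \<forall>n::nat. L \<le> real n \<longrightarrow> s \<notin> {s \<in> {0..real n}. g s = f s}"
    unfolding AE_all_countable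
  proof
    fix n :: nat
    show "AE s in lborel. L \<le> real n \<longrightarrow> s \<notin> {s \<in> {0..real n}. g s = f s}"
    proof (cases "L \<le> real n")
      case True
      from AE_not_in[OF null[OF this]] show ?thesis
        by eventually_elim blast
    qed simp
  qed
  then show ?thesis
  proof eventually_elim
    case (elim s)
    obtain n where "max L s \<le> real n"
      using real_arch_simple by blast
    with elim show ?case by auto
  qed
qed

text \<open>Let \<open>F n k\<close> be the time up to n at which the increment over
  \<open>h k\<close> is at most \<open>n * h k\<close>. By Fubini its mean is at most
  \<open>n\<^sup>2 * (1 / 2) ^ k\<close>, so Fatou's lemma makes its lower limit vanish almost
  surely. This event does not mention f, and it excludes all Lipschitz functions at once.\<close>

lemma (in prob_space) AE_avoids_lipschitz:
  fixes W :: "real \<Rightarrow> 'a \<Rightarrow> real"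
  assumes meas: "\<And>t. 0 \<le> t \<Longrightarrow> W t \<in> borel_measurable M"
    and cont: "AE \<omega> in M. continuous_on {0..} (\<lambda>t. W t \<omega>)"
    and small: "\<And>s t L. 0 \<le> s \<Longrightarrow> s < t \<Longrightarrow> 0 \<le> L \<Longrightarrow>
      emeasure M {\<omega> \<in> space M. \<bar>W t \<omega> - W s \<omega>\<bar> \<le> L * (t - s)} \<le> ennreal (L * sqrt (t - s))"
  shows "AE \<omega> in M. \<forall>L f. L-lipschitz_on {0..} f \<longrightarrow> (AE s in lborel. 0 \<le> s \<longrightarrow> W s \<omega> \<noteq> f s)"
proof -
  obtain N where N: "N \<in> null_sets M" "{\<omega> \<in> space M. \<not> continuous_on {0..} (\<lambda>t. W t \<omega>)} \<subseteq> N"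
    using cont by (auto elim!: AE_E simp: null_sets_def)
  \<comment> \<open>A modification with every path continuous on the whole line, as joint
    measurability requires: zero on the null set, constant at negative times.\<close>
  define Z where "Z t \<omega> = (if \<omega> \<in> N then 0 else W (max 0 t) \<omega>)" for t \<omega>
  have Z_meas [measurable]: "Z t \<in> borel_measurable M" for t
    unfolding Z_def using N(1) meas by (intro measurable_If_set) auto
  have Z_cont: "continuous_on UNIV (\<lambda>t. Z t \<omega>)" if "\<omega> \<in> space M" for \<omega>
  proof (cases "\<omega> \<in> N")
    case False
    with that N(2) have "continuous_on {0..} (\<lambda>t. W t \<omega>)" by auto
    then have "continuous_on UNIV (\<lambda>t. W (max 0 t) \<omega>)"
      by (rule continuous_on_compose2) (auto intro!: continuous_intros)
    with False show ?thesis by (simp add: Z_def)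
  qed (simp add: Z_def)
  have Z_joint [measurable]: "(\<lambda>(t, \<omega>). Z t \<omega>) \<in> borel_measurable (lborel \<Otimes>\<^sub>M M)"
    using Z_meas Z_cont by (rule borel_measurable_continuous_paths)
  have Z_joint' [measurable]: "(\<lambda>(t, \<omega>). Z (t + c) \<omega>) \<in> borel_measurable (lborel \<Otimes>\<^sub>M M)" for c
    by (rule borel_measurable_continuous_paths) (auto intro!: continuous_on_compose2[OF Z_cont] continuous_intros)
  \<comment> \<open>Powers of 1/4 make the square roots exact powers of 1/2.\<close>
  define h :: "nat \<Rightarrow> real" where "h k = 1 / 4 ^ k" for k
  have h: "0 < h k" for k by (simp add: h_def)
  have h_lim: "h \<longlonglongrightarrow> 0"
    unfolding h_def by (rule LIMSEQ_divide_realpow_zero) simp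
  define S where "S n k = {x \<in> space (lborel \<Otimes>\<^sub>M M). fst x \<in> {0..real n} \<and> \<bar>Z (fst x + h k) (snd x) - Z (fst x) (snd x)\<bar> \<le> real n * h k}"
    for n :: nat and k
  have S_sets [measurable]: "S n k \<in> sets (lborel \<Otimes>\<^sub>M M)" for n k
    using Z_joint Z_joint'[of "h k"] unfolding S_def case_prod_beta' by measurable
  define F where "F n k \<omega> = emeasure lborel ((\<lambda>s. (s, \<omega>)) -` S n k)" for n k \<omega>
  interpret P: pair_sigma_finite lborel M
    by unfold_locales
  have F_meas [measurable]: "F n k \<in> borel_measurable M" for n k
    unfolding F_def by (rule P.measurable_emeasure_Pair2) (rule S_sets)
  have F_int: "(\<integral>\<^sup>+\<omega>. F n k \<omega> \<partial>M) \<le> ennreal ((real n)\<^sup>2 * (1 / 2) ^ k)" for n k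
  proof -
    have "(\<integral>\<^sup>+\<omega>. F n k \<omega> \<partial>M) = emeasure (lborel \<Otimes>\<^sub>M M) (S n k)"
      unfolding F_def by (rule P.emeasure_pair_measure_alt2[symmetric]) (rule S_sets)
    also have "\<dots> = (\<integral>\<^sup>+s. emeasure M (Pair s -` S n k) \<partial>lborel)"
      by (rule emeasure_pair_measure_alt) (rule S_sets)
    also have "\<dots> \<le> (\<integral>\<^sup>+s. ennreal (real n * (1 / 2) ^ k) * indicator {0..real n} s \<partial>lborel)"
    proof (rule nn_integral_mono)
      fix s :: real
      show "emeasure M (Pair s -` S n k) \<le> ennreal (real n * (1 / 2) ^ k) * indicator {0..real n} s"
      proof (cases "s \<in> {0..real n}")
        case True
        let ?A = "{\<omega> \<in> space M. \<bar>W (s + h k) \<omega> - W s \<omega>\<bar> \<le> real n * ((s + h k) - s)}"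
        have [measurable]: "W (s + h k) \<in> borel_measurable M" "W s \<in> borel_measurable M"
          using True h[of k] by (auto intro!: meas)
        have "emeasure M (Pair s -` S n k) = emeasure M ?A"
        proof (rule emeasure_eq_AE)
          show "AE \<omega> in M. (\<omega> \<in> Pair s -` S n k) = (\<omega> \<in> ?A)"
            using AE_not_in[OF N(1)] AE_space
            by eventually_elim (use True h[of k] in \<open>auto simp: S_def Z_def space_pair_measure\<close>)
          show "Pair s -` S n k \<in> sets M"
            by (rule sets_Pair1) (rule S_sets)
        qed measurable
        also have "\<dots> \<le> ennreal (real n * sqrt ((s + h k) - s))"
          using True h[of k] by (intro small) auto
        also have "sqrt ((s + h k) - s) = (1 / 2) ^ k"
          by (simp add: h_def real_sqrt_divide real_sqrt_power power_one_over)
        finally show ?thesis using True by simp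
      next
        case False
        then have "Pair s -` S n k = {}" by (auto simp: S_def)
        then show ?thesis by simp
      qed
    qed
    also have "\<dots> = ennreal ((real n)\<^sup>2 * (1 / 2) ^ k)"
      by (subst nn_integral_cmult_indicator) (simp_all add: power2_eq_square ennreal_mult'[symmetric] mult_ac)
    finally show ?thesis .
  qed
  have "AE \<omega> in M. liminf (\<lambda>k. F n k \<omega>) = 0" for n
  proof -
    have "(\<integral>\<^sup>+\<omega>. liminf (\<lambda>k. F n k \<omega>) \<partial>M) \<le> liminf (\<lambda>k. \<integral>\<^sup>+\<omega>. F n k \<omega> \<partial>M)"
      by (rule nn_integral_liminf) measurable
    also have "\<dots> \<le> liminf (\<lambda>k. ennreal ((real n)\<^sup>2 * (1 / 2) ^ k))"
      using F_int by (intro Liminf_mono) auto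
    also have "\<dots> = ennreal 0"
    proof (intro lim_imp_Liminf tendsto_ennrealI)
      show "(\<lambda>k. (real n)\<^sup>2 * (1 / 2) ^ k) \<longlonglongrightarrow> 0"
        by (intro tendsto_mult_right_zero LIMSEQ_power_zero) simp
    qed simp
    finally show ?thesis
      by (subst nn_integral_0_iff_AE[symmetric]) auto
  qed
  then have "AE \<omega> in M. \<forall>n. liminf (\<lambda>k. F n k \<omega>) = 0"
    by (simp add: AE_all_countable)
  then show ?thesis
    using AE_not_in[OF N(1)] AE_space
  proof eventually_elim
    case (elim \<omega>)
    show ?case
    proof (intro allI impI)
      fix L f assume f: "L-lipschitz_on {0..} (f :: real \<Rightarrow> real)"
      have "(\<lambda>s. (s, \<omega>)) -` S n k = {s \<in> {0..real n}. \<bar>Z (s + h k) \<omega> - Z s \<omega>\<bar> \<le> real n * h k}" for n k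
        using elim(3) by (auto simp: S_def space_pair_measure)
      then have "AE s in lborel. 0 \<le> s \<longrightarrow> Z s \<omega> \<noteq> f s"
        using elim(1) by (intro AE_not_lipschitz[OF Z_cont[OF elim(3)] f h h_lim]) (simp add: F_def)
      then show "AE s in lborel. 0 \<le> s \<longrightarrow> W s \<omega> \<noteq> f s"
        by eventually_elim (use elim(2) in \<open>auto simp: Z_def\<close>)
    qed
  qed
qed

section \<open>Solutions\<close>

text \<open>The density is at most 1 / sqrt (4 pi v) \<le> 1 / (2 sqrt v), and the interval has
  length 2 L v. The variance is \<open>2 * v\<close> because X will be the difference of two
  independent Brownian increments over a time v.\<close>

lemma (in prob_space) normal_small_ball:
  assumes X: "distributed M lborel X (normal_density \<mu> (sqrt (2 * v)))" and "0 < v" "0 \<le> L"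
  shows "emeasure M {\<omega> \<in> space M. \<bar>X \<omega>\<bar> \<le> L * v} \<le> ennreal (L * sqrt v)"
proof -
  have "{\<omega> \<in> space M. \<bar>X \<omega>\<bar> \<le> L * v} = X -` {- (L * v)..L * v} \<inter> space M"
    by auto
  then have "emeasure M {\<omega> \<in> space M. \<bar>X \<omega>\<bar> \<le> L * v} =
      (\<integral>\<^sup>+x. ennreal (normal_density \<mu> (sqrt (2 * v)) x) * indicator {- (L * v)..L * v} x \<partial>lborel)"
    using distributed_emeasure[OF X, of "{- (L * v)..L * v}"] by simp
  also have "\<dots> \<le> (\<integral>\<^sup>+x. ennreal (1 / (2 * sqrt v)) * indicator {- (L * v)..L * v} x \<partial>lborel)"
  proof (intro nn_integral_mono mult_right_mono ennreal_leI)
    fix x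
    have "2 * sqrt v = sqrt (4 * v)"
      using \<open>0 < v\<close> by (simp add: real_sqrt_mult)
    also have "\<dots> \<le> sqrt (2 * pi * (sqrt (2 * v))\<^sup>2)"
      using \<open>0 < v\<close> pi_ge_two by simp
    finally have "1 / sqrt (2 * pi * (sqrt (2 * v))\<^sup>2) \<le> 1 / (2 * sqrt v)"
      using \<open>0 < v\<close> by (intro divide_left_mono) auto
    moreover have "exp (- (x - \<mu>)\<^sup>2 / (2 * (sqrt (2 * v))\<^sup>2)) \<le> 1"
      using \<open>0 < v\<close> by (simp add: divide_nonpos_pos)
    ultimately show "normal_density \<mu> (sqrt (2 * v)) x \<le> 1 / (2 * sqrt v)"
      unfolding normal_density_def
      using mult_mono[of "1 / sqrt (2 * pi * (sqrt (2 * v))\<^sup>2)" "1 / (2 * sqrt v)" "exp (- (x - \<mu>)\<^sup>2 / (2 * (sqrt (2 * v))\<^sup>2))" 1] \<open>0 < v\<close>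
      by simp
  qed auto
  also have "\<dots> = ennreal (1 / (2 * sqrt v)) * ennreal (2 * (L * v))"
    using assms by (subst nn_integral_cmult_indicator) auto
  also have "\<dots> = ennreal (L * sqrt v)"
    using assms by (subst ennreal_mult'[symmetric]) (auto simp: field_simps)
  finally show ?thesis .
qed

lemma (in prob_space) indep_vars_two:
  assumes "indep_vars (\<lambda>_. N) X UNIV" "i \<noteq> j"
  shows "indep_var N (X i) N (X j)"
proof -
  have "indep_var (PiM {i} (\<lambda>_. N)) (\<lambda>\<omega>. restrict (\<lambda>k. X k \<omega>) {i}) (PiM {j} (\<lambda>_. N)) (\<lambda>\<omega>. restrict (\<lambda>k. X k \<omega>) {j})"
    using assms by (intro indep_var_restrict) auto
  from indep_var_compose[OF this, of "\<lambda>f. f i" N "\<lambda>f. f j" N] show ?thesis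
    by (simp add: comp_def)
qed

lemma (in prob_space) brownian_component_diff_distributed:
  fixes B :: "real \<Rightarrow> 'a \<Rightarrow> real ^ 'n"
  assumes B: "independent_brownian_motions M B" and "i \<noteq> j" "0 \<le> s" "s < t"
  shows "distributed M lborel (\<lambda>\<omega>. (B t \<omega> $ i - B t \<omega> $ j) - (B s \<omega> $ i - B s \<omega> $ j)) (normal_density 0 (sqrt (2 * (t - s))))"
proof -
  have indep: "indep_vars (\<lambda>_. PiM {0..} (\<lambda>_. borel)) (\<lambda>i \<omega>. \<lambda>t\<in>{0..}. B t \<omega> $ i) UNIV"
    using B by (simp add: independent_brownian_motions_def)
  have [measurable]: "(\<lambda>f. f r) \<in> measurable (PiM {0..} (\<lambda>_. borel)) borel" if "0 \<le> r" for r :: real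
    using that by (intro measurable_component_singleton) auto
  have "(\<lambda>f. f t - f s) \<in> borel_measurable (PiM {0..} (\<lambda>_. borel :: real measure))"
    using assms by (intro borel_measurable_diff) auto
  from indep_vars_compose2[OF indep this]
  have "indep_vars (\<lambda>_. borel) (\<lambda>i \<omega>. B t \<omega> $ i - B s \<omega> $ i) UNIV"
    using assms by simp
  then have "indep_var borel (\<lambda>\<omega>. B t \<omega> $ i - B s \<omega> $ i) borel (\<lambda>\<omega>. B t \<omega> $ j - B s \<omega> $ j)"
    using \<open>i \<noteq> j\<close> by (rule indep_vars_two)
  moreover have "distributed M lborel (\<lambda>\<omega>. B t \<omega> $ k - B s \<omega> $ k) (normal_density 0 (sqrt (t - s)))" for k
    using B assms by (simp add: independent_brownian_motions_def standard_brownian_motion_def)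
  ultimately have "distributed M lborel (\<lambda>\<omega>. (B t \<omega> $ i - B s \<omega> $ i) - (B t \<omega> $ j - B s \<omega> $ j))
      (normal_density (0 - 0) (sqrt ((sqrt (t - s))\<^sup>2 + (sqrt (t - s))\<^sup>2)))"
    using \<open>s < t\<close> by (intro diff_indep_normal) auto
  then show ?thesis
    using \<open>s < t\<close> by (simp add: algebra_simps)
qed

lemma (in prob_space) AE_brownian_continuous:
  fixes B :: "real \<Rightarrow> 'a \<Rightarrow> real ^ 'n"
  assumes "independent_brownian_motions M B"
  shows "AE \<omega> in M. continuous_on {0..} (\<lambda>t. B t \<omega>)"
proof -
  have "AE \<omega> in M. \<forall>i. continuous_on {0..} (\<lambda>t. B t \<omega> $ i)"
    using assms by (intro eventually_all_finite) (simp add: independent_brownian_motions_def standard_brownian_motion_def)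
  then show ?thesis
  proof eventually_elim
    case (elim \<omega>)
    then have "continuous_on {0..} (\<lambda>t. \<chi> i. B t \<omega> $ i)"
      by (intro continuous_on_vec_lambda) auto
    then show ?case by simp
  qed
qed

lemma (in prob_space) AE_brownian_lipschitz_avoiding:
  fixes B :: "real \<Rightarrow> 'a \<Rightarrow> real ^ 'n"
  assumes B: "independent_brownian_motions M B"
  shows "AE \<omega> in M. lipschitz_avoiding (\<lambda>t. B t \<omega>)"
proof -
  have [measurable]: "(\<lambda>\<omega>. B t \<omega> $ i) \<in> borel_measurable M" if "0 \<le> t" for t i
    using B that by (simp add: independent_brownian_motions_def standard_brownian_motion_def)
  have "AE \<omega> in M. i \<noteq> j \<longrightarrow> (\<forall>L f. L-lipschitz_on {0..} f \<longrightarrow>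
      (AE s in lborel. 0 \<le> s \<longrightarrow> B s \<omega> $ i - B s \<omega> $ j \<noteq> f s))" for i j
  proof (cases "i = j")
    case False
    have "AE \<omega> in M. \<forall>L f. L-lipschitz_on {0..} f \<longrightarrow>
        (AE s in lborel. 0 \<le> s \<longrightarrow> B s \<omega> $ i - B s \<omega> $ j \<noteq> f s)"
    proof (rule AE_avoids_lipschitz)
      show "AE \<omega> in M. continuous_on {0..} (\<lambda>t. B t \<omega> $ i - B t \<omega> $ j)"
        using AE_brownian_continuous[OF B] by eventually_elim (intro continuous_intros)
      show "emeasure M {\<omega> \<in> space M. \<bar>(B t \<omega> $ i - B t \<omega> $ j) - (B s \<omega> $ i - B s \<omega> $ j)\<bar> \<le> L * (t - s)}
          \<le> ennreal (L * sqrt (t - s))" if "0 \<le> s" "s < t" "0 \<le> L" for s t L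
        using brownian_component_diff_distributed[OF B False that(1,2)] that by (intro normal_small_ball) auto
    qed measurable
    then show ?thesis by eventually_elim simp
  qed simp
  then have "AE \<omega> in M. \<forall>i j. i \<noteq> j \<longrightarrow> (\<forall>L f. L-lipschitz_on {0..} f \<longrightarrow>
      (AE s in lborel. 0 \<le> s \<longrightarrow> B s \<omega> $ i - B s \<omega> $ j \<noteq> f s))"
    by (intro eventually_all_finite)
  then show ?thesis
    by eventually_elim (auto simp: lipschitz_avoiding_def)
qed

text \<open>Solving for \<open>b\<close> turns a coincidence with f into one with
  \<open>(f s - (x $ i - x $ j)) / \<sigma>\<close>, which is again Lipschitz. The noise must be
  nondegenerate here.\<close>

lemma lipschitz_avoiding_affine:
  fixes b :: "real \<Rightarrow> real ^ 'n"
  assumes b: "lipschitz_avoiding b" and "0 < \<sigma>"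
  shows "lipschitz_avoiding (\<lambda>t. x + \<sigma> *\<^sub>R b t)"
  unfolding lipschitz_avoiding_def
proof (intro allI impI)
  fix i j :: 'n and L f assume "i \<noteq> j" and f: "L-lipschitz_on {0..} (f :: real \<Rightarrow> real)"
  have "(\<bar>1 / \<sigma>\<bar> * L)-lipschitz_on {0..} (\<lambda>s. (1 / \<sigma>) *\<^sub>R (f s - (x $ i - x $ j)))"
    using lipschitz_on_diff[OF f lipschitz_on_constant[of _ "x $ i - x $ j"]]
    by (intro lipschitz_on_cmult) simp
  with b \<open>i \<noteq> j\<close> have "AE s in lborel. 0 \<le> s \<longrightarrow> b s $ i - b s $ j \<noteq> (1 / \<sigma>) *\<^sub>R (f s - (x $ i - x $ j))"
    unfolding lipschitz_avoiding_def by blast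
  then show "AE s in lborel. 0 \<le> s \<longrightarrow> (x + \<sigma> *\<^sub>R b s) $ i - (x + \<sigma> *\<^sub>R b s) $ j \<noteq> f s"
    by eventually_elim (use \<open>0 < \<sigma>\<close> in \<open>auto simp: field_simps\<close>)
qed

section \<open>Comparison and uniqueness of solutions\<close>

lemma solution_AE_rank_path:
  fixes X :: "real \<Rightarrow> 'w \<Rightarrow> real ^ 'n"
  assumes "solution M F \<sigma> a B X0 X"
  shows "AE \<omega> in M. X 0 \<omega> = X0 \<omega> \<and> rank_path a (\<lambda>t. X0 \<omega> + \<sigma> *\<^sub>R B t \<omega>) (\<lambda>t. X t \<omega>)"
proof -
  from assms have "AE \<omega> in M. X 0 \<omega> = X0 \<omega> \<and> continuous_on {0..} (\<lambda>t. X t \<omega>) \<and>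
      (\<forall>t\<ge>0. \<forall>i. set_integrable lborel {0..t} (\<lambda>s. a (particle_rank (X s \<omega>) i)) \<and>
        X t \<omega> $ i = X0 \<omega> $ i + \<sigma> * B t \<omega> $ i - (LINT s:{0..t}|lborel. a (particle_rank (X s \<omega>) i)))"
    by (simp add: solution_def)
  then show ?thesis
    by eventually_elim (auto simp: rank_path_def)
qed

text \<open>The driving paths \<open>X0 + \<sigma> B\<close> and \<open>Y0 + \<sigma> B\<close>
  differ by a constant in time, so the path lemmas apply. Separate filtrations \<open>F\<close> and
  \<open>G\<close> allow a strong solution to be compared with a solution adapted to any other
  filtration.\<close>

lemma (in prob_space) solution_AE_compare:
  fixes X Y :: "real \<Rightarrow> 'a \<Rightarrow> real ^ 'n"
  assumes "0 < \<sigma>" and a: "mono_on {1..CARD('n)} a" and B: "independent_brownian_motions M B"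
    and "solution M F \<sigma> a B X0 X" "solution M G \<sigma> a B Y0 Y"
  shows "AE \<omega> in M. \<forall>t\<ge>0. (\<Sum>i\<in>UNIV. (X t \<omega> $ i - Y t \<omega> $ i)\<^sup>2) \<le> (\<Sum>i\<in>UNIV. (X0 \<omega> $ i - Y0 \<omega> $ i)\<^sup>2)"
    and "AE \<omega> in M. (\<forall>i. X0 \<omega> $ i \<le> Y0 \<omega> $ i) \<longrightarrow> (\<forall>t\<ge>0. \<forall>i. X t \<omega> $ i \<le> Y t \<omega> $ i)"
    and "AE \<omega> in M. (\<forall>i. X0 \<omega> $ i < Y0 \<omega> $ i) \<longrightarrow> (\<forall>t\<ge>0. \<forall>i. X t \<omega> $ i < Y t \<omega> $ i)"
proof -
  note AEs = AE_brownian_lipschitz_avoiding[OF B] solution_AE_rank_path[OF assms(4)] solution_AE_rank_path[OF assms(5)]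
  note avoid = lipschitz_avoiding_affine[OF _ \<open>0 < \<sigma>\<close>]
  show "AE \<omega> in M. \<forall>t\<ge>0. (\<Sum>i\<in>UNIV. (X t \<omega> $ i - Y t \<omega> $ i)\<^sup>2) \<le> (\<Sum>i\<in>UNIV. (X0 \<omega> $ i - Y0 \<omega> $ i)\<^sup>2)"
    using AEs
  proof eventually_elim
    case (elim \<omega>)
    then show ?case
      using rank_path_contraction[OF a avoid[OF elim(1)] avoid[OF elim(1)] _ conjunct2[OF elim(2)] conjunct2[OF elim(3)]] by simp
  qed
  show "AE \<omega> in M. (\<forall>i. X0 \<omega> $ i \<le> Y0 \<omega> $ i) \<longrightarrow> (\<forall>t\<ge>0. \<forall>i. X t \<omega> $ i \<le> Y t \<omega> $ i)"
    using AEs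
  proof eventually_elim
    case (elim \<omega>)
    then show ?case
      using rank_path_le[OF a avoid[OF elim(1)] avoid[OF elim(1)] _ conjunct2[OF elim(2)] conjunct2[OF elim(3)]] by simp
  qed
  show "AE \<omega> in M. (\<forall>i. X0 \<omega> $ i < Y0 \<omega> $ i) \<longrightarrow> (\<forall>t\<ge>0. \<forall>i. X t \<omega> $ i < Y t \<omega> $ i)"
    using AEs
  proof eventually_elim
    case (elim \<omega>)
    then show ?case
      using rank_path_less[OF a avoid[OF elim(1)] avoid[OF elim(1)] _ conjunct2[OF elim(2)] conjunct2[OF elim(3)]] by simp
  qed
qed

lemma (in prob_space) solution_unique:
  fixes X Y :: "real \<Rightarrow> 'a \<Rightarrow> real ^ 'n"
  assumes "0 < \<sigma>" "mono_on {1..CARD('n)} a" "independent_brownian_motions M B"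
    and "solution M F \<sigma> a B X0 X" "solution M G \<sigma> a B X0 Y"
  shows "indistinguishable M X Y"
  using solution_AE_compare(1)[OF assms] unfolding indistinguishable_def
proof eventually_elim
  case (elim \<omega>)
  show ?case
  proof (intro allI impI)
    fix t :: real assume "0 \<le> t"
    with elim have "(\<Sum>i\<in>UNIV. (X t \<omega> $ i - Y t \<omega> $ i)\<^sup>2) \<le> 0" by simp
    then have "(\<Sum>i\<in>UNIV. (X t \<omega> $ i - Y t \<omega> $ i)\<^sup>2) = 0"
      by (intro antisym sum_nonneg) auto
    then show "X t \<omega> = Y t \<omega>"
      by (simp add: sum_nonneg_eq_0_iff vec_eq_iff)
  qed
qed

section \<open>Existence of a strong solution\<close>

lemma augmented_filtration_measurable:
  fixes B :: "real \<Rightarrow> 'w \<Rightarrow> real ^ 'n"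
  shows "X0 \<in> borel_measurable (augmented_filtration M X0 B t)"
    and "\<And>s. 0 \<le> s \<Longrightarrow> s \<le> t \<Longrightarrow> B s \<in> borel_measurable (augmented_filtration M X0 B t)"
proof -
  let ?G = "{X0 -` A \<inter> space M | A. A \<in> sets borel} \<union>
        {B s -` A \<inter> space M | s A. 0 \<le> s \<and> s \<le> t \<and> A \<in> sets borel} \<union> null_sets M"
  have "?G \<subseteq> Pow (space M)"
    using sets.sets_into_space by (auto simp: null_sets_def)
  then have in_sets: "A \<in> sets (augmented_filtration M X0 B t)" if "A \<in> ?G" for A
    unfolding augmented_filtration_def using that by (rule in_measure_of)
  have space: "space (augmented_filtration M X0 B t) = space M"
    by (simp add: augmented_filtration_def space_measure_of_conv)
  show "X0 \<in> borel_measurable (augmented_filtration M X0 B t)"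
    by (rule measurableI) (auto simp: space intro!: in_sets)
  show "B s \<in> borel_measurable (augmented_filtration M X0 B t)" if "0 \<le> s" "s \<le> t" for s
    by (rule measurableI) (use that in \<open>auto simp: space intro!: in_sets\<close>)
qed

text \<open>The solution is one fixed functional of the path \<open>X0 + \<sigma> B\<close>, which
  makes it strong: adaptedness holds at every sample point by measurability of that functional, and
  the equation holds on the almost sure event where B is continuous, starts at 0 and avoids
  Lipschitz functions.\<close>

lemma (in prob_space) strong_solution_exists:
  fixes B :: "real \<Rightarrow> 'a \<Rightarrow> real ^ 'n"
  assumes "0 < \<sigma>" and a: "mono_on {1..CARD('n)} a" and B: "independent_brownian_motions M B"
  shows "\<exists>X. strong_solution M \<sigma> a B X0 X"
proof -
  define w where "w \<omega> t = X0 \<omega> + \<sigma> *\<^sub>R B t \<omega>" for \<omega> t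
  define X where "X t \<omega> = w \<omega> t - euler_limit a (w \<omega>) t" for t \<omega>
  have "solution M (augmented_filtration M X0 B) \<sigma> a B X0 X"
    unfolding solution_def
  proof (intro conjI allI impI)
    show "X0 \<in> borel_measurable (augmented_filtration M X0 B 0)"
      by (rule augmented_filtration_measurable)
    fix t :: real assume "0 \<le> t"
    have w_meas: "(\<lambda>\<omega>. w \<omega> s) \<in> borel_measurable (augmented_filtration M X0 B t)" if "0 \<le> s" "s \<le> t" for s
      unfolding w_def using that
      by (intro borel_measurable_add borel_measurable_scaleR augmented_filtration_measurable) auto
    then show "X t \<in> borel_measurable (augmented_filtration M X0 B t)"
      unfolding X_def using \<open>0 \<le> t\<close> by (intro borel_measurable_diff measurable_euler_limit) auto
  next
    have "AE \<omega> in M. \<forall>i. B 0 \<omega> $ i = 0"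
      using B by (intro eventually_all_finite) (simp add: independent_brownian_motions_def standard_brownian_motion_def)
    with AE_brownian_lipschitz_avoiding[OF B] AE_brownian_continuous[OF B]
    show "AE \<omega> in M. X 0 \<omega> = X0 \<omega> \<and> continuous_on {0..} (\<lambda>t. X t \<omega>) \<and>
        (\<forall>t\<ge>0. \<forall>i. set_integrable lborel {0..t} (\<lambda>s. a (particle_rank (X s \<omega>) i)) \<and>
          X t \<omega> $ i = X0 \<omega> $ i + \<sigma> * B t \<omega> $ i - (LINT s:{0..t}|lborel. a (particle_rank (X s \<omega>) i)))"
    proof eventually_elim
      case (elim \<omega>)
      have cont: "continuous_on {0..} (w \<omega>)"
        unfolding w_def using elim(2) by (intro continuous_intros)
      have "lipschitz_avoiding (w \<omega>)"
        unfolding w_def using elim(1) \<open>0 < \<sigma>\<close> by (rule lipschitz_avoiding_affine)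
      then have path: "rank_path a (w \<omega>) (\<lambda>t. X t \<omega>)"
        unfolding X_def by (rule euler_limit_rank_path[OF a cont])
      then have "X 0 \<omega> $ i = X0 \<omega> $ i" for i
        using elim(3) by (simp add: rank_path_def w_def set_integral_Icc_same[of 0, simplified])
      moreover have "continuous_on {0..} (\<lambda>t. X t \<omega>)"
        unfolding X_def by (rule euler_limit_continuous[OF a cont])
      ultimately show ?case
        using path by (simp add: rank_path_def w_def vec_eq_iff)
    qed
  qed
  then show ?thesis
    unfolding strong_solution_def by blast
qed

theorem proposition1p3:
  fixes M :: "'w measure" and \<sigma> :: real and a :: "nat \<Rightarrow> real"
    and B :: "real \<Rightarrow> 'w \<Rightarrow> real ^ 'n" and X0 :: "'w \<Rightarrow> real ^ 'n"
  assumes "prob_space M"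
    and "\<sigma> > 0"
    and "mono_on {1..CARD('n)} a"
    and "independent_brownian_motions M B"
    and "X0 \<in> borel_measurable M"
    and "independent_of_process M X0 B"
  shows
    "(\<exists>X. strong_solution M \<sigma> a B X0 X \<and>
        (\<forall>X'. strong_solution M \<sigma> a B X0 X' \<longrightarrow> indistinguishable M X' X) \<and>
        (\<forall>F X'. brownian_motion_wrt M F B \<and> solution M F \<sigma> a B X0 X' \<longrightarrow>
           indistinguishable M X' X)) \<and>
     (\<forall>F X Y0 Y.
        brownian_motion_wrt M F B \<and> solution M F \<sigma> a B X0 X \<and> solution M F \<sigma> a B Y0 Y \<longrightarrow>
        (AE \<omega> in M. \<forall>t\<ge>0.
           (\<Sum>i\<in>UNIV. (X t \<omega> $ i - Y t \<omega> $ i)\<^sup>2) \<le> (\<Sum>i\<in>UNIV. (X0 \<omega> $ i - Y0 \<omega> $ i)\<^sup>2)) \<and>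
        ((AE \<omega> in M. \<forall>i. X0 \<omega> $ i < Y0 \<omega> $ i) \<longrightarrow>
           (AE \<omega> in M. \<forall>t\<ge>0. \<forall>i. X t \<omega> $ i < Y t \<omega> $ i)) \<and>
        ((AE \<omega> in M. \<forall>i. X0 \<omega> $ i \<le> Y0 \<omega> $ i) \<longrightarrow>
           (AE \<omega> in M. \<forall>t\<ge>0. \<forall>i. X t \<omega> $ i \<le> Y t \<omega> $ i)))"
proof -
  interpret prob_space M by fact
  note compare = solution_AE_compare[OF assms(2-4)]
  note unique = solution_unique[OF assms(2-4)]
  obtain X where "strong_solution M \<sigma> a B X0 X"
    using strong_solution_exists[OF assms(2-4)] by blast
  \<comment> \<open>The comparisons carry the initial order as a premise inside the almost sure
    event; \<open>AE_mp\<close> turns it into the assumption that this order holds almost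
    surely.\<close>
  then show ?thesis
    unfolding strong_solution_def
    by (blast intro: unique compare(1) AE_mp compare(2,3))
qed

end
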